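(* Let $a_0,\dots,a_5\in\mathbb C$, let $C_1: a_0w_1^2+a_2w_2^2+a_4w_3^2+2a_3w_2w_3+2a_5w_1w_3+2a_1w_1w_2=0$ and $C_2: w_2^2-4w_1w_3=0$ be conics given by tangential equations, in general position, and let $F(s,x_1,x_2)=0$ be the point equation of the pencil $C_1+sC_2$ in Darboux coordinates with respect to $C_2$: $$F(s,x_1,x_2)=\det\begin{pmatrix}0&1&\frac{x_1+x_2}{2}&x_1x_2\\ 1&a_0&a_1&a_5-2s\\ \frac{x_1+x_2}{2}&a_1&a_2+s&a_3\\ x_1x_2&a_5-2s&a_3&a_4\end{pmatrix}.$$ Let $(\Gamma_2,\mathbb Z_2)$ be the two-valued coset group of the associated elliptic curve $\Gamma_2$, with operation $*$, and let $\circ$ be its action on $\Gamma_1$. Then the associativity conditions for the group structure and for the action, namely the equalities of $4$-multisets $$Q*(P*R)=(Q*P)*R\quad\text{for all group elements }P,Q,R,\qquad Q\circ(P\circ M)=(Q*P)\circ M\quad\text{for all group elements }P,Q\text{ and all }M\in\Gamma_1,$$ are equivalent to the Great Poncelet Theorem for a triangle for the pencil.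
   Context: General position means that the conics of the pencil have four distinct common tangents. One has $\mathcal D_sF=P(x_1)P(x_2)$ and $\mathcal D_{x_2}F=J(s)P(x_1)$ for a quartic $P$ and a cubic $J$ ($\mathcal D_y$ is the discriminant with respect to $y$); $\Gamma_1:\ y^2=P(x)$, $\Gamma_2:\ t^2=J(s)$. Two-valued group: $(\Gamma_2,\mathbb Z_2)$ is $\mathbb{CP}^1=\Gamma_2/\{\pm1\}$ (the set of values of the pencil parameter $s$, with unit $s=\infty$), with operation sending the classes of $A,B\in\Gamma_2$ to the unordered pair of classes of $A+B$ and $A-B$. Action: points of $\Gamma_1$ are considered through their coordinate $x$, i.e. through the tangent line to $C_2$ with parameter $x$; for a group element with pencil parameter $s$, $s\circ x=[y_1,y_2]$ where $y_1,y_2$ are the roots in $y$ of $F(s,x,y)=0$, i.e. the tangents to $C_2$ that meet the tangent with parameter $x$ on the conic of the pencil with parameter $s$. Products and actions of unordered pairs are taken elementwise, as multisets. Great Poncelet Theorem for triangles: let $K_1,K_2,K_3,C$ be four conics of the pencil and $a_1,a_2,a_3$ three lines tangent to $C$ such that $a_1,a_2$ intersect on $K_1$, $a_2,a_3$ intersect on $K_2$, and $a_1,a_3$ intersect on $K_3$, and such that the tangents to $K_1,K_2,K_3$ at these intersection points are not concurrent. Given lines $b_1,b_2$ tangent to $C$ which intersect on $K_1$, there exists a line $b_3$ tangent to $C$ such that the triple $(b_1,b_2,b_3)$ satisfies all the conditions satisfied by $(a_1,a_2,a_3)$. (Here $C=C_2$.)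
   Formalization: In the Great Poncelet Theorem, K1, K2, K3 are nondegenerate, and non-concurrency of the tangents is not asked of (b1,b2,b3) when some b_i is a common tangent of the pencil: there the tangents are always concurrent, so the literal theorem fails; the incidences are always asked. *)

theory Defs
  imports "HOL-Analysis.Analysis" "HOL-Computational_Algebra.Polynomial"
begin

datatype cp1 = Fin complex | Infty

fun hom_coords :: "cp1 \<Rightarrow> complex \<times> complex" where
  "hom_coords (Fin x) = (x, 1)"
| "hom_coords Infty = (1, 0)"


section \<open>The pencil of conics\<close>

text \<open>
  Points \<open>z\<close> and lines \<open>w\<close> of the projective plane are represented by non-zero vectors of
  \<open>complex^3\<close>; \<open>z\<close> lies on \<open>w\<close> iff \<open>z1 w1 + z2 w2 + z3 w3 = 0\<close>.  The coefficients
  \<open>a 0, \<dots>, a 5\<close> are the only values of \<open>a\<close> that are used.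
\<close>

definition incident :: "complex^3 \<Rightarrow> complex^3 \<Rightarrow> bool" where
  "incident z w \<longleftrightarrow> z$1 * w$1 + z$2 * w$2 + z$3 * w$3 = 0"

definition C1_form :: "(nat \<Rightarrow> complex) \<Rightarrow> complex^3 \<Rightarrow> complex" where
  "C1_form a w = a 0 * (w$1)^2 + a 2 * (w$2)^2 + a 4 * (w$3)^2
     + 2 * a 3 * w$2 * w$3 + 2 * a 5 * w$1 * w$3 + 2 * a 1 * w$1 * w$2"

definition C2_form :: "complex^3 \<Rightarrow> complex" where
  "C2_form w = (w$2)^2 - 4 * w$1 * w$3"

text \<open>Tangential equation of the conic with parameter \<open>s\<close>; the parameter \<open>Infty\<close> is \<open>C\<^sub>2\<close> itself.\<close>

fun pencil_form :: "(nat \<Rightarrow> complex) \<Rightarrow> cp1 \<Rightarrow> complex^3 \<Rightarrow> complex" where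
  "pencil_form a (Fin s) w = C1_form a w + s * C2_form w"
| "pencil_form a Infty w = C2_form w"

fun pencil_matrix :: "(nat \<Rightarrow> complex) \<Rightarrow> cp1 \<Rightarrow> complex^3^3" where
  "pencil_matrix a (Fin s) =
     vector [vector [a 0, a 1, a 5 - 2 * s],
             vector [a 1, a 2 + s, a 3],
             vector [a 5 - 2 * s, a 3, a 4]]"
| "pencil_matrix a Infty =
     vector [vector [0, 0, -2],
             vector [0, 1, 0],
             vector [-2, 0, 0]]"

lemma pencil_form_matrix:
  "pencil_form a s w = (\<Sum>i\<in>UNIV. \<Sum>j\<in>UNIV. pencil_matrix a s $ i $ j * w $ i * w $ j)"
  by (cases s) (simp_all add: sum_3 C1_form_def C2_form_def vector_3 power2_eq_square algebra_simps)

definition nondegenerate :: "(nat \<Rightarrow> complex) \<Rightarrow> cp1 \<Rightarrow> bool" where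
  "nondegenerate a s \<longleftrightarrow> det (pencil_matrix a s) \<noteq> 0"

definition point_form :: "(nat \<Rightarrow> complex) \<Rightarrow> cp1 \<Rightarrow> complex^3 \<Rightarrow> complex" where
  "point_form a s z = (let M = pencil_matrix a s in
     det (vector [vector [0,   z$1,   z$2,   z$3],
                  vector [z$1, M$1$1, M$1$2, M$1$3],
                  vector [z$2, M$2$1, M$2$2, M$2$3],
                  vector [z$3, M$3$1, M$3$2, M$3$3]] :: complex^4^4))"

definition tangent_at :: "(nat \<Rightarrow> complex) \<Rightarrow> cp1 \<Rightarrow> complex^3 \<Rightarrow> complex^3 \<Rightarrow> bool" where
  "tangent_at a s z w \<longleftrightarrow>
     point_form a s z = 0 \<and> w \<noteq> 0 \<and> pencil_form a s w = 0 \<and> incident z w"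

definition concurrent :: "complex^3 \<Rightarrow> complex^3 \<Rightarrow> complex^3 \<Rightarrow> bool" where
  "concurrent u v w \<longleftrightarrow> (\<exists>z. z \<noteq> 0 \<and> incident z u \<and> incident z v \<and> incident z w)"


section \<open>Darboux coordinates with respect to the second conic\<close>

text \<open>The tangent line to \<open>C\<^sub>2\<close> with parameter \<open>x\<close>: its points satisfy \<open>z1 x^2 - 2 z2 x + z3 = 0\<close>.\<close>

fun tangent_line :: "cp1 \<Rightarrow> complex^3" where
  "tangent_line (Fin x) = vector [x^2, - 2 * x, 1]"
| "tangent_line Infty = vector [1, 0, 0]"

text \<open>
  The point with Darboux coordinates \<open>(x, y)\<close>, in homogeneous form so that infinite parameters
  are covered.  For \<open>x = y\<close> this is the point of contact of the tangent with \<open>C\<^sub>2\<close>.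
\<close>

definition meet :: "cp1 \<Rightarrow> cp1 \<Rightarrow> complex^3" where
  "meet x y = (case hom_coords x of (x1, x0) \<Rightarrow> case hom_coords y of (y1, y0) \<Rightarrow>
     vector [x0 * y0, (x1 * y0 + x0 * y1) / 2, x1 * y1])"

lemma meet_Fin: "meet (Fin x) (Fin y) = vector [1, (x + y) / 2, x * y]"
  by (simp add: meet_def)

definition F :: "(nat \<Rightarrow> complex) \<Rightarrow> cp1 \<Rightarrow> cp1 \<Rightarrow> cp1 \<Rightarrow> complex" where
  "F a s x y = point_form a s (meet x y)"

lemma vector_4: "(vector [x, y, z, w] :: 'a::zero^4) $ 1 = x" "(vector [x, y, z, w] :: 'a^4) $ 2 = y"
  "(vector [x, y, z, w] :: 'a^4) $ 3 = z" "(vector [x, y, z, w] :: 'a^4) $ 4 = w"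
  unfolding vector_def by simp_all

lemma F_Fin:
  "F a (Fin s) (Fin x1) (Fin x2) =
     det (vector [vector [0, 1, (x1 + x2) / 2, x1 * x2],
                  vector [1, a 0, a 1, a 5 - 2 * s],
                  vector [(x1 + x2) / 2, a 1, a 2 + s, a 3],
                  vector [x1 * x2, a 5 - 2 * s, a 3, a 4]] :: complex^4^4)"
  by (simp add: F_def point_form_def meet_Fin)

lemma tangent_line_nonzero: "tangent_line x \<noteq> 0"
  by (cases x) (auto simp: vec_eq_iff forall_3)

lemma tangent_line_tangent: "C2_form (tangent_line x) = 0"
  by (cases x) (simp_all add: C2_form_def power2_eq_square)

lemma tangent_line_surj:
  assumes "w \<noteq> 0" "C2_form w = 0"
  shows "\<exists>!x. \<exists>c. c \<noteq> 0 \<and> w = c *s tangent_line x"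
proof (cases "w$3 = 0")
  case True
  then have 2: "w$2 = 0" using assms by (simp add: C2_form_def)
  then have 1: "w$1 \<noteq> 0" using assms True by (auto simp: vec_eq_iff forall_3)
  show ?thesis
  proof (rule ex1I[of _ Infty])
    show "\<exists>c. c \<noteq> 0 \<and> w = c *s tangent_line Infty"
      using 1 2 True by (auto simp: vec_eq_iff forall_3)
    show "x = Infty" if "\<exists>c. c \<noteq> 0 \<and> w = c *s tangent_line x" for x
      using that True by (cases x) auto
  qed
next
  case False
  show ?thesis
  proof (rule ex1I[of _ "Fin (- (w$2) / (2 * w$3))"])
    have "w$1 = (w$2)^2 / (4 * w$3)"
      using assms(2) False by (simp add: C2_form_def field_simps)
    then show "\<exists>c. c \<noteq> 0 \<and> w = c *s tangent_line (Fin (- (w$2) / (2 * w$3)))"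
      using False by (intro exI[of _ "w$3"])
        (simp add: vec_eq_iff forall_3 field_simps power2_eq_square)
    show "x = Fin (- (w$2) / (2 * w$3))" if "\<exists>c. c \<noteq> 0 \<and> w = c *s tangent_line x" for x
      using that False by (cases x) auto
  qed
qed

lemma incident_meet: "incident (meet x y) (tangent_line x)" "incident (meet x y) (tangent_line y)"
  by (cases x; cases y; simp add: incident_def meet_def power2_eq_square field_simps)+

lemma meet_nonzero: "meet x y \<noteq> 0"
  by (cases x; cases y) (auto simp: vec_eq_iff forall_3 meet_def)

lemma meet_unique:
  assumes "x \<noteq> y" "z \<noteq> 0" "incident z (tangent_line x)" "incident z (tangent_line y)"
  shows "\<exists>c. c \<noteq> 0 \<and> z = c *s meet x y"
proof (cases x)
  case x: (Fin u)
  show ?thesis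
  proof (cases y)
    case y: (Fin v)
    have uv: "u \<noteq> v" using assms x y by simp
    have 1: "z$1 * u^2 - 2 * z$2 * u + z$3 = 0" and 2: "z$1 * v^2 - 2 * z$2 * v + z$3 = 0"
      using assms(3,4) by (simp_all add: x y incident_def algebra_simps)
    have "(u - v) * (z$1 * (u + v) - 2 * z$2) = 0"
      using 1 2 by algebra
    then have 3: "z$2 = z$1 * ((u + v) / 2)" using uv by auto
    have 4: "z$3 = z$1 * (u * v)"
      using 1 3 by (simp add: power2_eq_square algebra_simps)
    show ?thesis
      using 3 4 assms(2) by (intro exI[of _ "z$1"]) (auto simp: x y meet_def vec_eq_iff forall_3)
  next
    case y: Infty
    show ?thesis
      using assms(2-4) by (intro exI[of _ "2 * z$2"])
        (auto simp: x y meet_def vec_eq_iff forall_3 incident_def algebra_simps)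
  qed
next
  case x: Infty
  then obtain v where y: "y = Fin v" using assms(1) by (cases y) auto
  show ?thesis
    using assms(2-4) by (intro exI[of _ "2 * z$2"])
      (auto simp: x y meet_def vec_eq_iff forall_3 incident_def algebra_simps)
qed

definition common_tangent :: "(nat \<Rightarrow> complex) \<Rightarrow> cp1 \<Rightarrow> bool" where
  "common_tangent a x \<longleftrightarrow> (\<forall>s. pencil_form a s (tangent_line x) = 0)"

definition general_position :: "(nat \<Rightarrow> complex) \<Rightarrow> bool" where
  "general_position a \<longleftrightarrow> card {x. common_tangent a x} = 4"


section \<open>Discriminants and the two curves\<close>

definition as_poly :: "(complex \<Rightarrow> complex) \<Rightarrow> complex poly" where
  "as_poly f = (THE p. \<forall>z. poly p z = f z)"

lemma as_poly_eqI: "(\<And>z. poly p z = f z) \<Longrightarrow> as_poly f = p"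
  unfolding as_poly_def by (rule the_equality) (auto simp: poly_eq_poly_eq_iff[symmetric] fun_eq_iff)

text \<open>The discriminant of a polynomial regarded as one of formal degree 2.\<close>

definition quadratic_disc :: "complex poly \<Rightarrow> complex" where
  "quadratic_disc p = (coeff p 1)^2 - 4 * coeff p 2 * coeff p 0"

text \<open>
  The two identities determine the pair \<open>(P, J)\<close> up to a common sign (if \<open>P \<noteq> 0\<close>).
\<close>

definition discriminant_factors :: "(nat \<Rightarrow> complex) \<Rightarrow> complex poly \<Rightarrow> complex poly \<Rightarrow> bool" where
  "discriminant_factors a P J \<longleftrightarrow>
     (\<forall>x1 x2. quadratic_disc (as_poly (\<lambda>s. F a (Fin s) (Fin x1) (Fin x2))) = poly P x1 * poly P x2) \<and>
     (\<forall>s x1. quadratic_disc (as_poly (\<lambda>x2. F a (Fin s) (Fin x1) (Fin x2))) = poly J s * poly P x1)"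

lemma det_4:
  "det (A::'a::comm_ring_1^4^4) =
     A$1$1 * (A$2$2 * (A$3$3 * A$4$4 - A$3$4 * A$4$3) - A$2$3 * (A$3$2 * A$4$4 - A$3$4 * A$4$2)
              + A$2$4 * (A$3$2 * A$4$3 - A$3$3 * A$4$2))
   - A$1$2 * (A$2$1 * (A$3$3 * A$4$4 - A$3$4 * A$4$3) - A$2$3 * (A$3$1 * A$4$4 - A$3$4 * A$4$1)
              + A$2$4 * (A$3$1 * A$4$3 - A$3$3 * A$4$1))
   + A$1$3 * (A$2$1 * (A$3$2 * A$4$4 - A$3$4 * A$4$2) - A$2$2 * (A$3$1 * A$4$4 - A$3$4 * A$4$1)
              + A$2$4 * (A$3$1 * A$4$2 - A$3$2 * A$4$1))
   - A$1$4 * (A$2$1 * (A$3$2 * A$4$3 - A$3$3 * A$4$2) - A$2$2 * (A$3$1 * A$4$3 - A$3$3 * A$4$1)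
              + A$2$3 * (A$3$1 * A$4$2 - A$3$2 * A$4$1))"
proof -
  have f1234: "finite {2::4, 3, 4}" "1 \<notin> {2::4, 3, 4}" by auto
  have f234: "finite {3::4, 4}" "2 \<notin> {3::4, 4}" by auto
  have f34: "finite {4::4}" "3 \<notin> {4::4}" by auto
  show ?thesis
    unfolding det_def UNIV_4
    unfolding sum_over_permutations_insert[OF f1234]
    unfolding sum_over_permutations_insert[OF f234]
    unfolding sum_over_permutations_insert[OF f34]
    unfolding permutes_sing
    by (simp add: sign_swap_id permutation_swap_id permutation_compose sign_compose sign_id
        swap_id_eq algebra_simps)
qed

lemma point_form_expand:
  "point_form a s z = (let M = pencil_matrix a s in
     - ((z$1)^2 * (M$2$2 * M$3$3 - M$2$3 * M$3$2))
     - (z$2)^2 * (M$1$1 * M$3$3 - M$1$3 * M$3$1)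
     - (z$3)^2 * (M$1$1 * M$2$2 - M$1$2 * M$2$1)
     + 2 * z$1 * z$2 * (M$1$2 * M$3$3 - M$1$3 * M$2$3)
     - 2 * z$1 * z$3 * (M$1$2 * M$2$3 - M$1$3 * M$2$2)
     + 2 * z$2 * z$3 * (M$1$1 * M$2$3 - M$1$2 * M$1$3))"
  by (cases s) (simp_all add: point_form_def det_4 vector_4 vector_3 Let_def power2_eq_square algebra_simps)

lemma disc_y_aux:
  fixes a0 a1 a3 a4 b m x :: complex
  defines "A \<equiv> - (b * a4 - a3^2)" and "B \<equiv> - (a0 * a4 - m^2)" and "C \<equiv> - (a0 * b - a1^2)"
    and "D \<equiv> 2 * (a1 * a4 - m * a3)" and "E \<equiv> - 2 * (a1 * a3 - m * b)"
    and "G \<equiv> 2 * (a0 * a3 - a1 * m)"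
  shows "(B * x / 2 + D / 2 + E * x + G * x^2 / 2)^2
      - 4 * (B / 4 + C * x^2 + G * x / 2) * (A + B * x^2 / 4 + D * x / 2) =
    (a0 * a3^2 + a1^2 * a4 + b * m^2 - a0 * b * a4 - 2 * a1 * a3 * m)
      * (a0 * x^4 - 4 * a1 * x^3 + (4 * b + 2 * m) * x^2 - 4 * a3 * x + a4)"
proof -
  have "(B * x + D + 2 * E * x + G * x^2)^2 - (B + 4 * C * x^2 + 2 * G * x) * (4 * A + B * x^2 + 2 * D * x) =
      4 * ((a0 * a3^2 + a1^2 * a4 + b * m^2 - a0 * b * a4 - 2 * a1 * a3 * m)
      * (a0 * x^4 - 4 * a1 * x^3 + (4 * b + 2 * m) * x^2 - 4 * a3 * x + a4))"
    unfolding A_def B_def C_def D_def E_def G_def by (simp add: eval_nat_numeral algebra_simps)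
  moreover have "(B * x / 2 + D / 2 + E * x + G * x^2 / 2)^2 = (B * x + D + 2 * E * x + G * x^2)^2 / 4"
    by (simp add: power2_eq_square field_simps)
  moreover have "4 * (B / 4 + C * x^2 + G * x / 2) * (A + B * x^2 / 4 + D * x / 2) =
      (B + 4 * C * x^2 + 2 * G * x) * (4 * A + B * x^2 + 2 * D * x) / 4"
    by (simp add: power2_eq_square field_simps)
  ultimately show ?thesis
    by (simp only: diff_divide_distrib[symmetric]) simp
qed

lemma ex_discriminant_factors:
  "\<exists>P J. discriminant_factors a P J \<and> degree P \<le> 4 \<and> degree J = 3"
proof -
  define P where "P = [:a 4, - 4 * a 3, 4 * a 2 + 2 * a 5, - 4 * a 1, a 0:]"
  define J where "J =
    [:a 0 * (a 3)^2 + (a 1)^2 * a 4 + a 2 * (a 5)^2 - a 0 * a 2 * a 4 - 2 * a 1 * a 3 * a 5,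
      (a 5)^2 - 4 * a 2 * a 5 + 4 * a 1 * a 3 - a 0 * a 4, 4 * a 2 - 4 * a 5, 4:]"
  have s: "as_poly (\<lambda>s. F a (Fin s) (Fin x) (Fin y)) = (let z2 = (x + y) / 2; z3 = x * y in
      [: - (a 2 * a 4 - (a 3)^2) - z2^2 * (a 0 * a 4 - (a 5)^2) - z3^2 * (a 0 * a 2 - (a 1)^2)
           + 2 * z2 * (a 1 * a 4 - a 5 * a 3) - 2 * z3 * (a 1 * a 3 - a 5 * a 2)
           + 2 * z2 * z3 * (a 0 * a 3 - a 1 * a 5),
         - a 4 - 4 * a 5 * z2^2 - a 0 * z3^2 + 4 * a 3 * z2 + 2 * z3 * (a 5 - 2 * a 2)
           + 4 * a 1 * z2 * z3,
         4 * z2^2 - 4 * z3 :])" for x y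
    by (rule as_poly_eqI)
      (simp add: F_def meet_Fin point_form_expand Let_def power2_eq_square field_simps)
  have y: "as_poly (\<lambda>y. F a (Fin s) (Fin x) (Fin y)) =
      (let b = a 2 + s; m = a 5 - 2 * s;
           A = - (b * a 4 - (a 3)^2); B = - (a 0 * a 4 - m^2); C = - (a 0 * b - (a 1)^2);
           D = 2 * (a 1 * a 4 - m * a 3); E = - 2 * (a 1 * a 3 - m * b); G = 2 * (a 0 * a 3 - a 1 * m)
       in [: A + B * x^2 / 4 + D * x / 2, B * x / 2 + D / 2 + E * x + G * x^2 / 2,
             B / 4 + C * x^2 + G * x / 2 :])" for s x
    by (rule as_poly_eqI)
      (simp add: F_def meet_Fin point_form_expand Let_def power2_eq_square field_simps)
  have qd: "quadratic_disc [:c0, c1, c2:] = c1^2 - 4 * c2 * c0" for c0 c1 c2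
    by (simp add: quadratic_disc_def numeral_2_eq_2)
  have "quadratic_disc (as_poly (\<lambda>s. F a (Fin s) (Fin x) (Fin y))) = poly P x * poly P y" for x y
    unfolding s P_def Let_def qd by (simp add: field_simps power2_eq_square)
  moreover have "quadratic_disc (as_poly (\<lambda>y. F a (Fin s) (Fin x) (Fin y))) = poly J s * poly P x"
    for s x
  proof -
    define b where "b = a 2 + s"
    define m where "m = a 5 - 2 * s"
    have "poly P x = a 0 * x^4 - 4 * a 1 * x^3 + (4 * b + 2 * m) * x^2 - 4 * a 3 * x + a 4"
      by (simp add: P_def b_def m_def power4_eq_xxxx power3_eq_cube power2_eq_square algebra_simps)
    moreover have "poly J s = a 0 * (a 3)^2 + (a 1)^2 * a 4 + b * m^2 - a 0 * b * a 4 - 2 * a 1 * a 3 * m"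
      by (simp add: J_def b_def m_def power2_eq_square algebra_simps)
    ultimately show ?thesis
      unfolding y Let_def qd b_def[symmetric] m_def[symmetric] by (simp only: disc_y_aux)
  qed
  ultimately have "discriminant_factors a P J"
    by (simp add: discriminant_factors_def)
  moreover have "degree P \<le> 4" "degree J = 3"
    by (simp_all add: P_def J_def)
  ultimately show ?thesis by blast
qed


section \<open>The two-valued group and its action\<close>

text \<open>
  The points of the smooth projective model of \<open>y\<^sup>2 = Q(x)\<close> for \<open>Q\<close> of degree 3 or 4: over
  \<open>x = \<infinity>\<close> the equation is \<open>y\<^sup>2 = coeff Q 4\<close>, so there are two points if \<open>Q\<close> has degree 4, and
  the single point \<open>(Infty, 0)\<close> if \<open>Q\<close> has degree 3.
\<close>

definition curve :: "complex poly \<Rightarrow> (cp1 \<times> complex) set" where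
  "curve Q = {(x, y). y^2 = (case x of Fin u \<Rightarrow> poly Q u | Infty \<Rightarrow> coeff Q 4)}"

definition ell_neg :: "cp1 \<times> complex \<Rightarrow> cp1 \<times> complex" where
  "ell_neg A = (fst A, - snd A)"

text \<open>
  Chord-tangent addition on \<open>t\<^sup>2 = J(s)\<close>, \<open>J\<close> a cubic (not necessarily monic), with neutral
  element \<open>(Infty, 0)\<close>.
\<close>

fun ell_add :: "complex poly \<Rightarrow> cp1 \<times> complex \<Rightarrow> cp1 \<times> complex \<Rightarrow> cp1 \<times> complex" where
  "ell_add J (Infty, t1) B = B"
| "ell_add J (Fin s1, t1) (Infty, t2) = (Fin s1, t1)"
| "ell_add J (Fin s1, t1) (Fin s2, t2) =
     (if s1 = s2 \<and> t1 = - t2 then (Infty, 0)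
      else let m = (if s1 = s2 then poly (pderiv J) s1 / (2 * t1) else (t2 - t1) / (s2 - s1));
               s3 = (m^2 - coeff J 2) / coeff J 3 - s1 - s2
           in (Fin s3, - (t1 + m * (s3 - s1))))"

text \<open>
  The class of \<open>(s, t)\<close> modulo \<open>\<plusminus>1\<close> is its coordinate \<open>s\<close>; the operation does not depend on the
  chosen representatives, see \<open>star_fst\<close>.
\<close>

definition rep :: "complex poly \<Rightarrow> cp1 \<Rightarrow> cp1 \<times> complex" where
  "rep J p = (SOME A. A \<in> curve J \<and> fst A = p)"

definition star :: "complex poly \<Rightarrow> cp1 \<Rightarrow> cp1 \<Rightarrow> cp1 multiset" where
  "star J p q = {# fst (ell_add J (rep J p) (rep J q)), fst (ell_add J (rep J p) (ell_neg (rep J q))) #}"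

lemma rep: "rep J p \<in> curve J" "fst (rep J p) = p"
proof -
  have "\<exists>y::complex. y^2 = c" for c
    by (rule exI[of _ "csqrt c"]) simp
  then obtain y where "y^2 = (case p of Fin u \<Rightarrow> poly J u | Infty \<Rightarrow> coeff J 4)" by blast
  then have "\<exists>A. A \<in> curve J \<and> fst A = p"
    by (intro exI[of _ "(p, y)"]) (simp add: curve_def)
  from someI_ex[OF this] show "rep J p \<in> curve J" "fst (rep J p) = p"
    by (auto simp: rep_def)
qed

lemma curve_fst_eq:
  assumes "A \<in> curve Q" "B \<in> curve Q" "fst A = fst B"
  shows "B = A \<or> B = ell_neg A"
proof -
  have "(snd B)^2 = (snd A)^2"
    using assms by (auto simp: curve_def)
  then have "snd B = snd A \<or> snd B = - snd A"
    by (simp add: power2_eq_iff)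
  then show ?thesis
    using assms(3) by (auto simp: ell_neg_def prod_eq_iff)
qed

lemma ell_add_neg:
  assumes "degree J = 3" "A \<in> curve J" "B \<in> curve J"
  shows "ell_add J (ell_neg A) (ell_neg B) = ell_neg (ell_add J A B)"
proof -
  have c4: "coeff J 4 = 0" using assms(1) by (intro coeff_eq_0) simp
  obtain p t q u where AB: "A = (p, t)" "B = (q, u)" by (cases A; cases B)
  show ?thesis
  proof (cases p)
    case p: (Fin s1)
    show ?thesis
    proof (cases q)
      case q: (Fin s2)
      show ?thesis
      proof (cases "s1 = s2")
        case True
        have "- t = u \<longleftrightarrow> t = - u" by auto
        then show ?thesis
          by (simp add: AB p q True ell_neg_def Let_def)
      next
        case False
        have "((t - u) / (s2 - s1))^2 = ((u - t) / (s2 - s1))^2"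
          by (simp add: power_divide power2_commute)
        moreover have "(t - u) / (s2 - s1) = - ((u - t) / (s2 - s1))"
          by (simp add: minus_divide_left)
        ultimately show ?thesis using False
          by (simp add: AB p q ell_neg_def Let_def)
      qed
    qed (use assms c4 in \<open>auto simp: AB p ell_neg_def curve_def\<close>)
  qed (use assms c4 in \<open>auto simp: AB ell_neg_def curve_def\<close>)
qed

lemma star_fst:
  assumes J: "degree J = 3" and A: "A \<in> curve J" and B: "B \<in> curve J"
  shows "star J (fst A) (fst B) = {# fst (ell_add J A B), fst (ell_add J A (ell_neg B)) #}"
proof -
  have neg: "ell_neg C \<in> curve J" if "C \<in> curve J" for C
    using that by (auto simp: curve_def ell_neg_def)
  have nn: "ell_neg (ell_neg C) = C" for C by (simp add: ell_neg_def)
  have fn: "fst (ell_neg C) = fst C" for C by (simp add: ell_neg_def)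
  have 1: "fst (ell_add J (ell_neg C) (ell_neg D)) = fst (ell_add J C D)"
    if "C \<in> curve J" "D \<in> curve J" for C D
    using ell_add_neg[OF J that] fn by simp
  have 2: "fst (ell_add J (ell_neg C) D) = fst (ell_add J C (ell_neg D))"
    if "C \<in> curve J" "D \<in> curve J" for C D
    using 1[OF that(1) neg[OF that(2)]] nn by simp
  have "rep J (fst A) = A \<or> rep J (fst A) = ell_neg A" "rep J (fst B) = B \<or> rep J (fst B) = ell_neg B"
    using curve_fst_eq[OF A rep(1)] curve_fst_eq[OF B rep(1)] rep(2) by metis+
  moreover have "fst (ell_add J (ell_neg A) B) = fst (ell_add J A (ell_neg B))"
    "fst (ell_add J (ell_neg A) (ell_neg B)) = fst (ell_add J A B)"
    using 1 2 A B by blast+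
  ultimately show ?thesis
    unfolding star_def by (elim disjE) (simp_all only: nn add_mset_commute)
qed

text \<open>
  The roots in \<open>\<complex>\<P>\<^sup>1\<close>, with multiplicities, of a non-zero polynomial of formal degree 2:
  infinity is a root of multiplicity \<open>2 - degree p\<close>.
\<close>

definition quadratic_roots :: "complex poly \<Rightarrow> cp1 multiset" where
  "quadratic_roots p = image_mset Fin (proots p) + replicate_mset (2 - degree p) Infty"

definition act :: "(nat \<Rightarrow> complex) \<Rightarrow> cp1 \<Rightarrow> cp1 \<Rightarrow> cp1 multiset" where
  "act a s x = quadratic_roots (as_poly (\<lambda>y. F a s x (Fin y)))"

definition group_associativity :: "complex poly \<Rightarrow> bool" where
  "group_associativity J \<longleftrightarrow>
     (\<forall>P Q R. (\<Sum>S\<in>#star J P R. star J Q S) = (\<Sum>S\<in>#star J Q P. star J S R))"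

definition action_associativity ::
    "(nat \<Rightarrow> complex) \<Rightarrow> complex poly \<Rightarrow> complex poly \<Rightarrow> bool" where
  "action_associativity a \<Gamma>\<^sub>1 J \<longleftrightarrow>
     (\<forall>P Q. \<forall>M\<in>curve \<Gamma>\<^sub>1.
        (\<Sum>x\<in>#act a P (fst M). act a Q x) = (\<Sum>S\<in>#star J Q P. act a S (fst M)))"


section \<open>The Great Poncelet Theorem for triangles\<close>

definition inscribed :: "(nat \<Rightarrow> complex) \<Rightarrow> cp1 \<Rightarrow> cp1 \<Rightarrow> cp1 \<Rightarrow> cp1 \<Rightarrow> cp1 \<Rightarrow> cp1 \<Rightarrow> bool" where
  "inscribed a K1 K2 K3 x1 x2 x3 \<longleftrightarrow> F a K1 x1 x2 = 0 \<and> F a K2 x2 x3 = 0 \<and> F a K3 x1 x3 = 0"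

text \<open>
  For a nondegenerate conic and a point on it, \<open>tangent_at\<close> determines the line up to scaling.
\<close>

definition tangents_not_concurrent ::
    "(nat \<Rightarrow> complex) \<Rightarrow> cp1 \<Rightarrow> cp1 \<Rightarrow> cp1 \<Rightarrow> cp1 \<Rightarrow> cp1 \<Rightarrow> cp1 \<Rightarrow> bool" where
  "tangents_not_concurrent a K1 K2 K3 x1 x2 x3 \<longleftrightarrow>
     (\<forall>t1 t2 t3. tangent_at a K1 (meet x1 x2) t1 \<longrightarrow> tangent_at a K2 (meet x2 x3) t2 \<longrightarrow>
        tangent_at a K3 (meet x1 x3) t3 \<longrightarrow> \<not> concurrent t1 t2 t3)"

lemma ex_tangent_at:
  assumes "z \<noteq> 0" "point_form a s z = 0"
  shows "\<exists>t. tangent_at a s z t"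
proof -
  have root: "\<exists>p q. (p, q) \<noteq> (0, 0) \<and> A * p^2 + B * p * q + C * q^2 = 0" for A B C :: complex
  proof (cases "A = 0")
    case True
    then show ?thesis by (intro exI[of _ 1] exI[of _ 0]) simp
  next
    case False
    define d where "d = csqrt (B^2 - 4 * A * C)"
    have d: "d^2 = B^2 - 4 * A * C" by (simp add: d_def)
    define p where "p = (d - B) / (2 * A)"
    have "2 * A * p = d - B" using False by (simp add: p_def)
    then have "(2 * A * p + B)^2 = B^2 - 4 * A * C" using d by simp
    then have "4 * A * (A * p^2 + B * p + C) = 0"
      by (simp add: power2_eq_square algebra_simps)
    then show ?thesis using False by (intro exI[of _ p] exI[of _ 1]) simp
  qed
  have key: "\<exists>t. tangent_at a s z t"
    if uv: "incident z u" "incident z v"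
      and ind: "\<And>p q. p *s u + q *s v = 0 \<Longrightarrow> (p, q) = (0, 0)" for u v
  proof -
    have bil: "pencil_form a s (p *s u + q *s v) = pencil_form a s u * p^2
        + (pencil_form a s (u + v) - pencil_form a s u - pencil_form a s v) * p * q
        + pencil_form a s v * q^2" for p q
      by (cases s) (simp_all add: C1_form_def C2_form_def power2_eq_square algebra_simps)
    obtain p q where pq: "(p, q) \<noteq> (0, 0)" "pencil_form a s (p *s u + q *s v) = 0"
      using root[of "pencil_form a s u" "pencil_form a s (u + v) - pencil_form a s u - pencil_form a s v"
        "pencil_form a s v"] unfolding bil by blast
    define w where "w = p *s u + q *s v"
    have "z$1 * w$1 + z$2 * w$2 + z$3 * w$3 =
        p * (z$1 * u$1 + z$2 * u$2 + z$3 * u$3) + q * (z$1 * v$1 + z$2 * v$2 + z$3 * v$3)"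
      by (simp add: w_def algebra_simps)
    then have "incident z w" using uv by (simp add: incident_def)
    moreover have "w \<noteq> 0" using pq(1) ind unfolding w_def by blast
    ultimately show ?thesis
      using pq(2) assms(2) unfolding w_def tangent_at_def by blast
  qed
  from assms(1) consider "z$1 \<noteq> 0" | "z$2 \<noteq> 0" | "z$3 \<noteq> 0"
    by (auto simp: vec_eq_iff forall_3)
  then show ?thesis
  proof cases
    case 1
    then show ?thesis
      by (intro key[of "vector [- (z$2), z$1, 0]" "vector [- (z$3), 0, z$1]"])
        (auto simp: incident_def vec_eq_iff forall_3)
  next
    case 2
    then show ?thesis
      by (intro key[of "vector [z$2, - (z$1), 0]" "vector [0, - (z$3), z$2]"])
        (auto simp: incident_def vec_eq_iff forall_3)
  next
    case 3
    then show ?thesis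
      by (intro key[of "vector [z$3, 0, - (z$1)]" "vector [0, z$3, - (z$2)]"])
        (auto simp: incident_def vec_eq_iff forall_3)
  qed
qed

lemma ex_common_point: "\<exists>z. z \<noteq> 0 \<and> incident z u \<and> incident z v"
proof -
  define A :: "complex^3^3" where "A = vector [u, v, v]"
  have "det A = 0"
    by (simp add: A_def det_3)
  then have "\<not> (\<exists>B. B ** A = mat 1)"
    using invertible_det_nz[of A] invertible_left_inverse[of A] by simp
  then obtain z where "A *v z = 0" "z \<noteq> 0"
    unfolding matrix_left_invertible_ker by blast
  then show ?thesis
    by (intro exI[of _ z])
      (auto simp: A_def vec_eq_iff forall_3 matrix_vector_mult_def sum_3 incident_def mult.commute)
qed

lemma common_tangent_concurrent:
  assumes "inscribed a K1 K2 K3 x1 x2 x3"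
    and "common_tangent a x1 \<or> common_tangent a x2 \<or> common_tangent a x3"
  shows "\<not> tangents_not_concurrent a K1 K2 K3 x1 x2 x3"
proof -
  have on: "point_form a K1 (meet x1 x2) = 0" "point_form a K2 (meet x2 x3) = 0"
    "point_form a K3 (meet x1 x3) = 0"
    using assms(1) by (simp_all add: inscribed_def F_def)
  obtain t1 t2 t3 where t: "tangent_at a K1 (meet x1 x2) t1" "tangent_at a K2 (meet x2 x3) t2"
    "tangent_at a K3 (meet x1 x3) t3"
    using ex_tangent_at on meet_nonzero by metis
  have c: "tangent_at a K (meet x y) (tangent_line x)" "tangent_at a K (meet y x) (tangent_line x)"
    if "common_tangent a x" "point_form a K (meet x y) = 0 \<or> point_form a K (meet y x) = 0" for K x y
  proof -
    have "meet x y = meet y x"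
      by (simp add: meet_def split: prod.splits) (simp add: algebra_simps)
    then show "tangent_at a K (meet x y) (tangent_line x)" "tangent_at a K (meet y x) (tangent_line x)"
      using that incident_meet[of x y] tangent_line_nonzero
      by (auto simp: tangent_at_def common_tangent_def)
  qed
  from assms(2) show ?thesis
  proof (elim disjE)
    assume x: "common_tangent a x1"
    obtain z where "z \<noteq> 0" "incident z (tangent_line x1)" "incident z t2"
      using ex_common_point by blast
    then show ?thesis
      using c[OF x] on t unfolding tangents_not_concurrent_def concurrent_def by blast
  next
    assume x: "common_tangent a x2"
    obtain z where "z \<noteq> 0" "incident z (tangent_line x2)" "incident z t3"
      using ex_common_point by blast
    then show ?thesis
      using c[OF x] on t unfolding tangents_not_concurrent_def concurrent_def by blast
  next
    assume x: "common_tangent a x3"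
    obtain z where "z \<noteq> 0" "incident z (tangent_line x3)" "incident z t1"
      using ex_common_point by blast
    then show ?thesis
      using c[OF x] on t unfolding tangents_not_concurrent_def concurrent_def by blast
  qed
qed

text \<open>
  The four conics of the theorem are \<open>K1\<close>, \<open>K2\<close>, \<open>K3\<close> and \<open>C\<^sub>2\<close>; tangent lines to \<open>C\<^sub>2\<close> are
  given by their parameters.  If one of the lines \<open>b1\<close>, \<open>b2\<close>, \<open>b3\<close> is a
  common tangent of the pencil, then two of the three tangents in question coincide with that line,
  and the tangents are concurrent (see \<open>common_tangent_concurrent\<close>); only in this degenerate case the
  condition on the tangents is not asked of the \<open>b\<close>'s.
\<close>

definition great_poncelet_triangle :: "(nat \<Rightarrow> complex) \<Rightarrow> bool" where
  "great_poncelet_triangle a \<longleftrightarrow>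
     (\<forall>K1 K2 K3 a1 a2 a3 b1 b2.
        nondegenerate a K1 \<longrightarrow> nondegenerate a K2 \<longrightarrow> nondegenerate a K3 \<longrightarrow>
        inscribed a K1 K2 K3 a1 a2 a3 \<longrightarrow> tangents_not_concurrent a K1 K2 K3 a1 a2 a3 \<longrightarrow>
        F a K1 b1 b2 = 0 \<longrightarrow>
        (\<exists>b3. inscribed a K1 K2 K3 b1 b2 b3 \<and>
           (common_tangent a b1 \<or> common_tangent a b2 \<or> common_tangent a b3 \<or>
            tangents_not_concurrent a K1 K2 K3 b1 b2 b3)))"

end

theory Submission
  imports Defs
begin

text \<open>
  Both sides of the equivalence hold for every pencil in general position, and both follow from the
  abelian group law on the smooth cubic \<open>\<Gamma>\<^sub>2 : t\<^sup>2 = J(s)\<close>.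

  \<^bold>\<open>The group law.\<close>  Only associativity is not immediate, and it is a statement about differences:
  \<open>(A1 - A2) + (A2 - A3) = A1 - A3\<close> (\<open>diff_add_diff\<close>).  The three points \<open>A1 - A2\<close>, \<open>A2 - A3\<close>,
  \<open>A3 - A1\<close> are collinear because the Gram determinant of three tangents of a conic with respect to
  the pencil is, on the one hand, \<open>J\<close> up to a constant and, on the other hand, a product of three
  linear factors minus a square (\<open>diff_add_diff_distinct\<close>).  The associativity of the two-valued group
  is then immediate.

  \<^bold>\<open>The action.\<close>  Let \<open>e\<close> be one of the four common tangents.  Through the intersection of \<open>e\<close> with the
  tangent \<open>x\<close> passes only one conic of the pencil.  Its parameter \<open>\<phi> x\<close> is a fractional
  linear function of \<open>x\<close>, and in this coordinate \<open>F\<close> becomes the symmetric form that expresses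
  two-valued addition on the cubic (\<open>addition_form_weierstrass\<close>).  So the action on tangents is the
  two-valued addition itself, transported by \<open>\<phi>\<close> (\<open>act_eq\<close>), and it is associative as well.

  \<^bold>\<open>The Great Poncelet Theorem.\<close>  Choose points \<open>A\<^sub>i\<close> of the cubic over the sides of the triangle.
  A conic passes through the intersection of the sides \<open>i\<close> and \<open>j\<close> exactly if it is the class of
  \<open>A\<^sub>i - A\<^sub>j\<close> or of \<open>A\<^sub>i + A\<^sub>j\<close> (\<open>F_eq_0_iff\<close>), and the sign also determines which line is the
  tangent of the conic at this point (\<open>tangent_at_difference\<close>).  After a change of signs of the
  \<open>A\<^sub>i\<close> the first two conics are the classes of \<open>k1 = A1 - A2\<close> and \<open>k2 = A2 - A3\<close>.  The three tangents
  are concurrent if the third conic is the class of \<open>A1 + A3\<close> (\<open>concurrent_if_sum\<close>), so it is the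
  class of \<open>A1 - A3 = k1 + k2\<close>.  This relation between the conics no longer mentions the triangle:
  starting from \<open>B1 - B2 = k1\<close>, the point \<open>B3 = B2 - k2\<close> closes the new triangle.
\<close>

section \<open>The chord-tangent group of a smooth cubic\<close>
locale smooth_cubic =
  fixes J :: "complex poly"
  assumes degree_J: "degree J = 3"
    and smooth: "poly J s = 0 \<Longrightarrow> poly (pderiv J) s \<noteq> 0"
begin

abbreviation "c0 \<equiv> coeff J 0"
abbreviation "c1 \<equiv> coeff J 1"
abbreviation "c2 \<equiv> coeff J 2"
abbreviation "c3 \<equiv> coeff J 3"

abbreviation add (infixl "\<oplus>" 65) where "A \<oplus> B \<equiv> ell_add J A B"
abbreviation sub (infixl "\<ominus>" 65) where "A \<ominus> B \<equiv> ell_add J A (ell_neg B)"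
abbreviation zero ("\<O>") where "\<O> \<equiv> (Infty, 0::complex)"
abbreviation E where "E \<equiv> curve J"

lemma c3_nonzero: "c3 \<noteq> 0"
  using degree_J leading_coeff_0_iff[of J] by auto

lemma J_eq: "J = [:c0, c1, c2, c3:]"
proof (rule poly_eqI)
  fix n
  show "coeff J n = coeff [:c0, c1, c2, c3:] n"
  proof (cases "n \<le> 3")
    case True
    then have "n = 0 \<or> n = 1 \<or> n = 2 \<or> n = 3" by auto
    then show ?thesis by (auto simp: numeral_2_eq_2 numeral_3_eq_3)
  next
    case False
    then have "coeff J n = 0" using degree_J by (simp add: coeff_eq_0)
    moreover have "coeff [:c0, c1, c2, c3:] n = 0"
      using False by (intro coeff_eq_0) (auto intro: le_less_trans[OF degree_pCons_le])
    ultimately show ?thesis by simp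
  qed
qed

lemma poly_J: "poly J z = c3 * z^3 + c2 * z^2 + c1 * z + c0"
  by (subst J_eq) (simp add: power2_eq_square power3_eq_cube algebra_simps)

lemma poly_pderiv_J: "poly (pderiv J) z = 3 * c3 * z^2 + 2 * c2 * z + c1"
  by (subst J_eq) (simp add: pderiv_pCons power2_eq_square algebra_simps)

lemma Infty_in_E: "(Infty, t) \<in> E \<longleftrightarrow> t = 0"
  using degree_J by (simp add: curve_def coeff_eq_0)

lemma Fin_in_E: "(Fin s, t) \<in> E \<longleftrightarrow> t^2 = poly J s"
  by (simp add: curve_def)

lemma E_cases [consumes 1, case_names zero affine]:
  assumes "A \<in> E"
  obtains "A = \<O>" | s t where "A = (Fin s, t)" "t^2 = poly J s"
  using assms by (cases A; cases "fst A") (auto simp: Infty_in_E Fin_in_E)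

lemma neg_simps [simp]: "ell_neg (s, t) = (s, - t)" "ell_neg (ell_neg A) = A" "fst (ell_neg A) = fst A"
  by (simp_all add: ell_neg_def)

lemma neg_closed [simp]: "ell_neg A \<in> E \<longleftrightarrow> A \<in> E"
  by (auto simp: curve_def ell_neg_def)

text \<open>
  The line \<open>t = m s + n\<close> meets the cubic in the points over \<open>s1\<close>, \<open>s2\<close>, \<open>s3\<close>.  Asking for an
  identity of polynomials in \<open>z\<close> records intersection multiplicities, so that chords and tangents
  are the same case.
\<close>
definition line_section :: "complex \<Rightarrow> complex \<Rightarrow> complex \<Rightarrow> complex \<Rightarrow> complex \<Rightarrow> bool" where
  "line_section m n s1 s2 s3 \<longleftrightarrow>
     (\<forall>z. poly J z - (m * z + n)^2 = c3 * (z - s1) * (z - s2) * (z - s3))"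

lemma line_section_iff:
  "line_section m n s1 s2 s3 \<longleftrightarrow>
     m^2 = c2 + c3 * (s1 + s2 + s3) \<and> 2 * m * n = c1 - c3 * (s1 * s2 + s1 * s3 + s2 * s3) \<and>
     n^2 = c0 + c3 * s1 * s2 * s3" (is "_ \<longleftrightarrow> ?R")
proof -
  have "line_section m n s1 s2 s3 \<longleftrightarrow>
      [:c0 - n^2, c1 - 2 * m * n, c2 - m^2, c3:] =
      [:- c3 * s1 * s2 * s3, c3 * (s1 * s2 + s1 * s3 + s2 * s3), - c3 * (s1 + s2 + s3), c3:]"
    unfolding line_section_def poly_eq_poly_eq_iff[symmetric] fun_eq_iff
    by (intro iff_allI arg_cong2[where f = "(=)"])
      (simp_all add: poly_J power2_eq_square power3_eq_cube algebra_simps)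
  also have "\<dots> \<longleftrightarrow> ?R" by (auto simp: algebra_simps)
  finally show ?thesis .
qed

lemma line_section_perm:
  assumes "line_section m n s1 s2 s3"
  shows "line_section m n s2 s1 s3" "line_section m n s3 s2 s1" "line_section (- m) (- n) s1 s2 s3"
  using assms by (auto simp: line_section_iff algebra_simps)

text \<open>
  If \<open>s1 = s2\<close>, the polynomial \<open>J - (m z + n)\<^sup>2\<close> has a double zero there, which says that \<open>m\<close> is
  the slope of the tangent; its ordinate is not zero because \<open>J\<close> has no double zero.
\<close>
lemma collinear_add:
  assumes "line_section m n s1 s2 s3"
  shows "(Fin s1, m * s1 + n) \<oplus> (Fin s2, m * s2 + n) = (Fin s3, - (m * s3 + n))"
proof -
  have e: "m^2 = c2 + c3 * (s1 + s2 + s3)" "2 * m * n = c1 - c3 * (s1 * s2 + s1 * s3 + s2 * s3)"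
     "n^2 = c0 + c3 * s1 * s2 * s3"
    using assms by (simp_all add: line_section_iff)
  have s3: "(m^2 - c2) / c3 - s1 - s2 = s3"
    using e(1) c3_nonzero by (simp add: field_simps)
  show ?thesis
  proof (cases "s1 = s2")
    case False
    have "((m * s2 + n) - (m * s1 + n)) / (s2 - s1) = m"
      using False by (simp add: field_simps)
    then show ?thesis
      using False by (simp only: ell_add.simps s3 Let_def simp_thms if_False) (simp add: algebra_simps)
  next
    case True
    have d: "poly (pderiv J) s1 = 2 * m * (m * s1 + n)"
      using e(1,2) unfolding poly_pderiv_J True by algebra
    have "poly J s1 = (m * s1 + n)^2"
      using assms[unfolded line_section_def, rule_format, of s1] by simp
    then have t: "m * s1 + n \<noteq> 0" using smooth[of s1] d by auto
    have "2 * m * q / (2 * q) = m" if "q \<noteq> 0" for q using that by simp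
    from this[OF t] have "poly (pderiv J) s1 / (2 * (m * s1 + n)) = m" by (simp only: d)
    moreover have "m * s1 + n \<noteq> - (m * s1 + n)"
      using t by (metis add_eq_0_iff2 mult_2 mult_eq_0_iff zero_neq_numeral)
    ultimately show ?thesis
      using s3 unfolding True
      by (simp only: ell_add.simps Let_def simp_thms if_False if_True) (simp add: algebra_simps)
  qed
qed

text \<open>
  The converse of \<open>collinear_add\<close>: two points that are not opposite lie on a line, the tangent if
  they coincide.  The third zero \<open>s3\<close> is read off from the quadratic coefficient; the other two
  coefficients agree because \<open>s1\<close> and \<open>s2\<close> are zeros.
\<close>
lemma line_through:
  assumes 1: "t1^2 = poly J s1" and 2: "t2^2 = poly J s2" and no: "\<not> (s1 = s2 \<and> t1 = - t2)"
  obtains m n s3 where "line_section m n s1 s2 s3" "t1 = m * s1 + n" "t2 = m * s2 + n"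
proof -
  define m where "m = (if s1 = s2 then poly (pderiv J) s1 / (2 * t1) else (t2 - t1) / (s2 - s1))"
  define n where "n = t1 - m * s1"
  define s3 where "s3 = (m^2 - c2) / c3 - s1 - s2"
  have t1: "t1 = m * s1 + n" by (simp add: n_def)
  have a: "m^2 = c2 + c3 * (s1 + s2 + s3)" using c3_nonzero by (simp add: s3_def field_simps)
  have e1: "(m * s1 + n)^2 = c3 * s1^3 + c2 * s1^2 + c1 * s1 + c0" using 1 t1 poly_J by simp
  show ?thesis
  proof (cases "s1 = s2")
    case False
    then have "m * (s2 - s1) = t2 - t1" by (simp add: m_def)
    then have t2: "t2 = m * s2 + n" by (simp add: n_def algebra_simps)
    have e2: "(m * s2 + n)^2 = c3 * s2^3 + c2 * s2^2 + c1 * s2 + c0" using 2 t2 poly_J by simp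
    have "(s1 - s2) * (2 * m * n) = (s1 - s2) * (c1 - c3 * (s1 * s2 + s1 * s3 + s2 * s3))"
      using e1 e2 a by algebra
    then have b: "2 * m * n = c1 - c3 * (s1 * s2 + s1 * s3 + s2 * s3)" using False by simp
    have "n^2 = c0 + c3 * s1 * s2 * s3" using e1 a b by algebra
    then show ?thesis using a b t1 t2 that by (simp add: line_section_iff)
  next
    case True
    have t0: "t1 \<noteq> 0"
    proof
      assume "t1 = 0"
      then show False using 1 2 True no by simp
    qed
    have "(t2 - t1) * (t2 + t1) = 0" using 1 2 True by (simp add: algebra_simps power2_eq_square)
    then have t2: "t2 = m * s2 + n" using no True t1 by (auto simp: add_eq_0_iff)
    have "2 * t1 * m = poly (pderiv J) s1" using t0 True by (simp add: m_def)
    then have d: "2 * (m * s1 + n) * m = 3 * c3 * s1^2 + 2 * c2 * s1 + c1"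
      using t1 poly_pderiv_J by simp
    have b: "2 * m * n = c1 - c3 * (s1 * s2 + s1 * s3 + s2 * s3)"
      using d a unfolding True by algebra
    have "n^2 = c0 + c3 * s1 * s2 * s3" using e1 a b unfolding True by algebra
    then show ?thesis using a b t1 t2 that by (simp add: line_section_iff)
  qed
qed

lemma add_zero [simp]: "\<O> \<oplus> A = A" "A \<in> E \<Longrightarrow> A \<oplus> \<O> = A"
  by (auto elim: E_cases)

lemma add_neg_self [simp]: "A \<in> E \<Longrightarrow> A \<ominus> A = \<O>" "A \<in> E \<Longrightarrow> ell_neg A \<oplus> A = \<O>"
  by (auto elim: E_cases)

lemma neg_add: "A \<in> E \<Longrightarrow> B \<in> E \<Longrightarrow> ell_neg (A \<oplus> B) = ell_neg A \<ominus> B"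
  using ell_add_neg[OF degree_J] by simp

lemma add_cases [consumes 2, case_names left_zero right_zero opposite chord]:
  assumes "A \<in> E" "B \<in> E"
  obtains "A = \<O>" | "B = \<O>" | "B = ell_neg A" |
    m n s1 s2 s3 where "A = (Fin s1, m * s1 + n)" "B = (Fin s2, m * s2 + n)" "line_section m n s1 s2 s3"
  using assms(1)
proof (cases rule: E_cases)
  case zero then show ?thesis using that(1) by blast
next
  case 1: (affine s1 t1)
  show ?thesis
    using assms(2)
  proof (cases rule: E_cases)
    case zero then show ?thesis using that(2) by blast
  next
    case 2: (affine s2 t2)
    show ?thesis
    proof (cases "s1 = s2 \<and> t1 = - t2")
      case True then show ?thesis using 1 2 that(3) by simp
    next
      case False
      then show ?thesis using line_through[OF 1(2) 2(2)] 1 2 that(4) by metis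
    qed
  qed
qed

lemma add_commute:
  assumes "A \<in> E" "B \<in> E"
  shows "A \<oplus> B = B \<oplus> A"
  using assms
proof (cases rule: add_cases)
  case (chord m n s1 s2 s3)
  then show ?thesis using collinear_add[OF chord(3)] collinear_add[OF line_section_perm(1)[OF chord(3)]] by simp
qed (use assms in auto)

lemma add_closed [simp]:
  assumes "A \<in> E" "B \<in> E"
  shows "A \<oplus> B \<in> E"
  using assms
proof (cases rule: add_cases)
  case (chord m n s1 s2 s3)
  have "(m * s3 + n)^2 = poly J s3"
    using chord(3)[unfolded line_section_def, rule_format, of s3] by simp
  then show ?thesis unfolding chord(1,2) collinear_add[OF chord(3)] Fin_in_E power2_minus .
qed (use assms in \<open>auto simp: Infty_in_E\<close>)

text \<open>
  The line through \<open>A\<close>, \<open>B\<close> and \<open>-(A + B)\<close>, reflected in the axis, passes through \<open>A + B\<close>, \<open>-B\<close>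
  and \<open>-A\<close>.
\<close>
lemma add_diff_cancel:
  assumes "A \<in> E" "B \<in> E"
  shows "(A \<oplus> B) \<ominus> B = A"
  using assms
proof (cases rule: add_cases)
  case (chord m n s1 s2 s3)
  have "line_section (- m) (- n) s3 s2 s1"
    using chord(3) line_section_perm by blast
  from collinear_add[OF this] show ?thesis
    using chord collinear_add[OF chord(3)] by simp
qed (use assms in auto)

lemma diff_add_cancel:
  assumes "A \<in> E" "B \<in> E"
  shows "(A \<ominus> B) \<oplus> B = A"
  using add_diff_cancel[of A "ell_neg B"] assms by simp

end

text \<open>
  The numbers \<open>g x y\<close> are the Gram matrix of the vectors \<open>(1, x, x\<^sup>2)\<close> for a symmetric form with
  determinant \<open>- 2 d3\<^sup>2 (d3 z\<^sup>3 + d2 z\<^sup>2 + d1 z + d0)\<close>, so its determinant is that number times a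
  squared Vandermonde determinant.
\<close>
lemma gram_det:
  fixes x1 x2 x3 z d0 d1 d2 d3 :: complex
  defines "g \<equiv> \<lambda>x y. d3 * x * y * (x + y) + 2 * d2 * x * y + d1 * (x + y) + 2 * d0 - d3 * z * (x - y)^2"
  shows "g x1 x1 * g x2 x2 * g x3 x3 + 2 * g x1 x2 * g x1 x3 * g x2 x3 - g x1 x1 * (g x2 x3)^2
     - g x2 x2 * (g x1 x3)^2 - g x3 x3 * (g x1 x2)^2 =
    - 2 * d3^2 * ((x1 - x2) * (x2 - x3) * (x3 - x1))^2 * (d3 * z^3 + d2 * z^2 + d1 * z + d0)"
proof -
  define V :: "complex^3^3" where
    "V = vector [vector [1, x1, x1^2], vector [1, x2, x2^2], vector [1, x3, x3^2]]"
  define M :: "complex^3^3" where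
    "M = vector [vector [2 * d0, d1, - (d3 * z)], vector [d1, 2 * d2 + 2 * d3 * z, d3], vector [- (d3 * z), d3, 0]]"
  have entries: "V ** M ** transpose V = vector [vector [g x1 x1, g x1 x2, g x1 x3],
      vector [g x1 x2, g x2 x2, g x2 x3], vector [g x1 x3, g x2 x3, g x3 x3]]"
    by (simp add: vec_eq_iff forall_3 V_def M_def matrix_matrix_mult_def sum_3 transpose_def g_def
        power2_eq_square algebra_simps)
  have "det V = (x1 - x2) * (x2 - x3) * (x3 - x1)"
    by (simp add: V_def det_3 power2_eq_square algebra_simps)
  moreover have "det M = - 2 * d3^2 * (d3 * z^3 + d2 * z^2 + d1 * z + d0)"
    by (simp add: M_def det_3 power2_eq_square power3_eq_cube algebra_simps)
  ultimately have "det (V ** M ** transpose V) =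
      - 2 * d3^2 * ((x1 - x2) * (x2 - x3) * (x3 - x1))^2 * (d3 * z^3 + d2 * z^2 + d1 * z + d0)"
    by (simp add: det_mul det_transpose power2_eq_square)
  then show ?thesis
    unfolding entries by (simp add: det_3 power2_eq_square algebra_simps)
qed

context smooth_cubic
begin

(* Sums of affine points are computed by collinear_add and polar_diff only. *)
declare ell_add.simps(3) [simp del]

text \<open>
  A pencil of symmetric biquadratic polarizations of \<open>2 J\<close>: on the diagonal the parameter \<open>z\<close> drops
  out.  Off the diagonal, \<open>z\<close> is the abscissa of a difference or a sum of points over \<open>x\<close> and \<open>y\<close>
  exactly if the value is \<open>-2\<close> or \<open>2\<close> times the product of the ordinates.
\<close>
definition polar :: "complex \<Rightarrow> complex \<Rightarrow> complex \<Rightarrow> complex" where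
  "polar z x y = c3 * x * y * (x + y) + 2 * c2 * x * y + c1 * (x + y) + 2 * c0 - c3 * z * (x - y)^2"

lemma polar_self: "polar z x x = 2 * poly J x"
  by (simp add: polar_def poly_J power2_eq_square power3_eq_cube algebra_simps)

lemma polar_commute: "polar z x y = polar z y x"
  by (simp add: polar_def power2_eq_square algebra_simps)

lemma polar_affine: "polar z x y = polar w x y - c3 * (z - w) * (x - y)^2"
  by (simp add: polar_def algebra_simps)

lemma polar_diff:
  assumes "x1 \<noteq> x2" "y1^2 = poly J x1" "y2^2 = poly J x2"
  obtains s where "(Fin x1, y1) \<ominus> (Fin x2, y2) = (Fin s, (y2 * (x1 - s) + y1 * (x2 - s)) / (x1 - x2))"
    and "polar s x1 x2 = - 2 * y1 * y2"
proof -
  define l where "l = (- y2 - y1) / (x2 - x1)"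
  define s where "s = (l^2 - c2) / c3 - x1 - x2"
  have l: "l * (x2 - x1) = - (y1 + y2)" using assms(1) by (simp add: l_def)
  have s: "l^2 = c3 * (s + x1 + x2) + c2" using c3_nonzero by (simp add: s_def)
  have "- (y1 + l * (s - x1)) * (x1 - x2) = y2 * (x1 - s) + y1 * (x2 - s)"
    using l by algebra
  then have t: "- (y1 + l * (s - x1)) = (y2 * (x1 - s) + y1 * (x2 - s)) / (x1 - x2)"
    using assms(1) by (metis eq_divide_eq right_minus_eq)
  have "(Fin x1, y1) \<ominus> (Fin x2, y2) = (Fin s, - (y1 + l * (s - x1)))"
    using assms(1) by (simp add: l_def s_def Let_def ell_add.simps(3))
  moreover have "polar s x1 x2 = - 2 * y1 * y2"
    using assms(2,3) l s unfolding polar_def poly_J by algebra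
  ultimately show ?thesis using that unfolding t by blast
qed

text \<open>
  As a polynomial in \<open>w\<close>, the left-hand side is quadratic and vanishes at \<open>x1\<close> and \<open>x2\<close>, so it is
  determined by its leading coefficient.
\<close>
lemma polar_mixed:
  assumes "x1 \<noteq> x2" "y1^2 = poly J x1" "y2^2 = poly J x2" "polar s x1 x2 = - 2 * y1 * y2"
  shows "y2 * polar s x1 w + y1 * polar s x2 w = c3 * (y2 * (x1 - s) + y1 * (x2 - s)) * (w - x1) * (w - x2)"
proof -
  define f where "f w = y2 * polar s x1 w + y1 * polar s x2 w
    - c3 * (y2 * (x1 - s) + y1 * (x2 - s)) * (w - x1) * (w - x2)" for w
  have "(x1 - x2) * f w = (w - x2) * f x1 - (w - x1) * f x2"
    by (simp add: f_def polar_def power2_eq_square algebra_simps)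
  moreover have "f x1 = 0"
    using assms(2,4) by (simp add: f_def polar_self polar_commute[of s x2] power2_eq_square flip: assms(2))
  moreover have "f x2 = 0"
    using assms(3,4) by (simp add: f_def polar_self power2_eq_square flip: assms(3))
  ultimately show ?thesis using assms(1) by (simp add: f_def)
qed

text \<open>
  This carries the associative law.  The points \<open>A1 - A2\<close>, \<open>A2 - A3\<close>, \<open>A3 - A1\<close> lie on a line,
  because the Gram determinant of \<open>polar z\<close> at \<open>x1, x2, x3\<close> can be computed in two ways.  By
  \<open>gram_det\<close> it is \<open>J z\<close> up to a constant.  Writing the off-diagonal entries as
  \<open>-2 y\<^sub>i y\<^sub>j + U\<^sub>i\<^sub>j\<close> with \<open>U\<^sub>i\<^sub>j\<close> linear in \<open>z\<close>, it is \<open>2 U\<^sub>1\<^sub>2 U\<^sub>2\<^sub>3 U\<^sub>3\<^sub>1 - 2 L\<^sup>2\<close> with \<open>L\<close> linear in \<open>z\<close>,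
  and the product of the \<open>U\<^sub>i\<^sub>j\<close> vanishes at the abscissae of the three differences.  Some of these
  differences may coincide.
\<close>
lemma diff_add_diff_distinct:
  assumes d: "x1 \<noteq> x2" "x2 \<noteq> x3" "x3 \<noteq> x1"
    and y: "y1^2 = poly J x1" "y2^2 = poly J x2" "y3^2 = poly J x3"
  shows "((Fin x1, y1) \<ominus> (Fin x2, y2)) \<oplus> ((Fin x2, y2) \<ominus> (Fin x3, y3)) = (Fin x1, y1) \<ominus> (Fin x3, y3)"
proof -
  define D where "D = (x1 - x2) * (x2 - x3) * (x3 - x1)"
  have D: "D \<noteq> 0" using d by (simp add: D_def)
  obtain s12 where A: "(Fin x1, y1) \<ominus> (Fin x2, y2) = (Fin s12, (y2 * (x1 - s12) + y1 * (x2 - s12)) / (x1 - x2))"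
    and p12: "polar s12 x1 x2 = - 2 * y1 * y2" using polar_diff[OF d(1) y(1,2)] .
  obtain s23 where B: "(Fin x2, y2) \<ominus> (Fin x3, y3) = (Fin s23, (y3 * (x2 - s23) + y2 * (x3 - s23)) / (x2 - x3))"
    and p23: "polar s23 x2 x3 = - 2 * y2 * y3" using polar_diff[OF d(2) y(2,3)] .
  obtain s31 where C: "(Fin x3, y3) \<ominus> (Fin x1, y1) = (Fin s31, (y1 * (x3 - s31) + y3 * (x1 - s31)) / (x3 - x1))"
    and p31: "polar s31 x3 x1 = - 2 * y3 * y1" using polar_diff[OF d(3) y(3,1)] .
  \<comment> \<open>The square root in the second evaluation of the Gram determinant; it is linear in \<open>z\<close>, and
     \<open>t = - L s / (c3 D)\<close> is the line.\<close>
  define L where "L z = y3 * (2 * y1 * y2 + polar z x1 x2) + y1 * (2 * y2 * y3 + polar z x2 x3)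
    + y2 * (2 * y3 * y1 + polar z x3 x1) - 4 * y1 * y2 * y3" for z
  define m where "m = (y3 * (x1 - x2)^2 + y1 * (x2 - x3)^2 + y2 * (x3 - x1)^2) / D"
  define n where "n = - L 0 / (c3 * D)"
  have line: "m * z + n = - L z / (c3 * D)" for z
  proof -
    have mD: "m * D = y3 * (x1 - x2)^2 + y1 * (x2 - x3)^2 + y2 * (x3 - x1)^2"
      using D by (simp add: m_def)
    have Lz: "L z = L 0 - c3 * (m * D) * z"
      unfolding mD by (simp add: L_def polar_def algebra_simps)
    show ?thesis using D c3_nonzero by (simp add: n_def Lz diff_divide_distrib)
  qed
  have U: "2 * y1 * y2 + polar z x1 x2 = - c3 * (z - s12) * (x1 - x2)^2"
    "2 * y2 * y3 + polar z x2 x3 = - c3 * (z - s23) * (x2 - x3)^2"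
    "2 * y3 * y1 + polar z x3 x1 = - c3 * (z - s31) * (x3 - x1)^2" for z
    using p12 p23 p31 by (simp_all add: polar_affine[of z x1 x2 s12] polar_affine[of z x2 x3 s23] polar_affine[of z x3 x1 s31])
  have line_sec: "line_section m n s12 s23 s31"
    unfolding line_section_def
  proof
    fix z
    define U V W where "U = 2 * y1 * y2 + polar z x1 x2" and "V = 2 * y2 * y3 + polar z x2 x3"
      and "W = 2 * y3 * y1 + polar z x3 x1"
    have e: "polar z x1 x2 = U - 2 * y1 * y2" "polar z x2 x3 = V - 2 * y2 * y3" "polar z x1 x3 = W - 2 * y3 * y1"
      by (simp_all add: U_def V_def W_def polar_commute)
    have "- 2 * c3^2 * D^2 * poly J z = polar z x1 x1 * polar z x2 x2 * polar z x3 x3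
        + 2 * polar z x1 x2 * polar z x1 x3 * polar z x2 x3 - polar z x1 x1 * (polar z x2 x3)^2
        - polar z x2 x2 * (polar z x1 x3)^2 - polar z x3 x3 * (polar z x1 x2)^2"
      unfolding D_def poly_J polar_def gram_det ..
    also have "\<dots> = 2 * (U * V * W) - 2 * (L z)^2"
      unfolding polar_self y[symmetric] L_def U_def[symmetric] V_def[symmetric] W_def[symmetric] unfolding e
      by algebra
    also have "U * V * W = - (c3^3 * D^2 * ((z - s12) * (z - s23) * (z - s31)))"
      unfolding U_def V_def W_def U D_def by algebra
    finally have "c3^2 * D^2 * poly J z = (L z)^2 + c3^2 * D^2 * (c3 * (z - s12) * (z - s23) * (z - s31))"
      by algebra
    moreover have "(L z)^2 = c3^2 * D^2 * (m * z + n)^2"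
      using D c3_nonzero by (simp add: line power_divide power_mult_distrib)
    ultimately have "c3^2 * D^2 * poly J z = c3^2 * D^2 * ((m * z + n)^2 + c3 * (z - s12) * (z - s23) * (z - s31))"
      by (simp add: algebra_simps)
    then show "poly J z - (m * z + n)^2 = c3 * (z - s12) * (z - s23) * (z - s31)"
      using D c3_nonzero by simp
  qed
  have on_line: "(y2 * (x1 - s) + y1 * (x2 - s)) / (x1 - x2) = m * s + n"
    if "polar s x1 x2 = - 2 * y1 * y2" "x1 \<noteq> x2" "y1^2 = poly J x1" "y2^2 = poly J x2"
      "D = (x1 - x2) * (x2 - x3) * (x3 - x1)"
      "L s = y3 * (2 * y1 * y2 + polar s x1 x2) + y1 * (2 * y2 * y3 + polar s x2 x3)
    + y2 * (2 * y3 * y1 + polar s x3 x1) - 4 * y1 * y2 * y3"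
    for s x1 x2 x3 y1 y2 y3
  proof -
    have "L s = y2 * polar s x1 x3 + y1 * polar s x2 x3"
      using that(1) unfolding that(6) by (simp add: polar_commute[of s x3] algebra_simps)
    also have "\<dots> = c3 * (y2 * (x1 - s) + y1 * (x2 - s)) * (x3 - x1) * (x3 - x2)"
      using polar_mixed[OF that(2,3,4,1)] .
    finally have "L s * (x1 - x2) = - c3 * D * (y2 * (x1 - s) + y1 * (x2 - s))"
      unfolding that(5) by algebra
    then show ?thesis using D c3_nonzero \<open>x1 \<noteq> x2\<close> unfolding line by (simp add: field_simps)
  qed
  have 1: "(Fin x1, y1) \<ominus> (Fin x2, y2) = (Fin s12, m * s12 + n)"
    unfolding A using on_line[OF p12 d(1) y(1,2), of x3 y3] by (simp add: D_def L_def algebra_simps)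
  have 2: "(Fin x2, y2) \<ominus> (Fin x3, y3) = (Fin s23, m * s23 + n)"
    unfolding B using on_line[OF p23 d(2) y(2,3), of x1 y1] by (simp add: D_def L_def algebra_simps)
  have 3: "(Fin x3, y3) \<ominus> (Fin x1, y1) = (Fin s31, m * s31 + n)"
    unfolding C using on_line[OF p31 d(3) y(3,1), of x2 y2] by (simp add: D_def L_def algebra_simps)
  have "(Fin x1, y1) \<ominus> (Fin x3, y3) = ell_neg ((Fin x3, y3) \<ominus> (Fin x1, y1))"
    using y add_commute[of "(Fin x1, y1)" "ell_neg (Fin x3, y3)"]
    by (simp add: neg_add Fin_in_E del: ell_add.simps)
  then show ?thesis
    unfolding 1 2 3 collinear_add[OF line_sec] by simp
qed

text \<open>
  The limiting case \<open>A3 = - A1\<close> of \<open>diff_add_diff_distinct\<close>.  The tangent at \<open>A\<close> gives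
  \<open>J = (\<mu> z + n0)\<^sup>2 + c3 (z - x)\<^sup>2 (z - s2)\<close>, where \<open>s2\<close> belongs to \<open>A + A\<close>.  For every line through
  the third point of the tangent the factor \<open>z - s2\<close> splits off, and for one such line the
  remaining quadratic factor has the abscissae of \<open>A - B\<close> and \<open>A + B\<close> as its zeros.
\<close>
lemma diff_add_sum:
  assumes A: "A \<in> E" and B: "B \<in> E"
  shows "(A \<ominus> B) \<oplus> (A \<oplus> B) = A \<oplus> A"
proof (cases "A = \<O> \<or> B = \<O> \<or> A = ell_neg A \<or> fst A = fst B")
  case True
  then consider "A = \<O>" | "B = \<O>" | "A = ell_neg A" | "A = B" | "A = ell_neg B"
    using curve_fst_eq[OF A B] by fastforce
  then show ?thesis
  proof cases
    case 3
    then have "A \<oplus> A = \<O>" using add_neg_self[OF A] by simp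
    moreover have "A \<ominus> B = ell_neg (A \<oplus> B)" using neg_add[OF A B] 3 by simp
    ultimately show ?thesis using A B by simp
  qed (use A B in \<open>auto simp: neg_add\<close>)
next
  case False
  obtain x y where A': "A = (Fin x, y)" "y^2 = poly J x" using A False by (auto elim: E_cases)
  obtain u v where B': "B = (Fin u, v)" "v^2 = poly J u" using B False by (auto elim: E_cases)
  have xu: "u - x \<noteq> 0" and y: "y \<noteq> 0" using False A' B' by auto
  define h where "h = u - x"
  obtain \<mu> n0 s2 where t: "line_section \<mu> n0 x x s2" "y = \<mu> * x + n0"
    using line_through[OF A'(2,2)] y by (metis add_eq_0_iff2 mult_2 mult_eq_0_iff zero_neq_numeral)
  have double: "A \<oplus> A = (Fin s2, - (\<mu> * s2 + n0))"
    unfolding A' t(2) by (rule collinear_add[OF t(1)])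
  \<comment> \<open>Adding a multiple of \<open>z - s2\<close> turns the tangent about its third point; the factor \<open>2 y / h\<close>
     makes the line pass through \<open>A - B\<close> and \<open>A + B\<close>.\<close>
  define m where "m = \<mu> + 2 * y / h"
  define n where "n = n0 - 2 * y * s2 / h"
  have line: "m * z + n = \<mu> * z + n0 + 2 * y / h * (z - s2)" for z
    by (simp add: m_def n_def algebra_simps diff_divide_distrib)
  have c: "\<mu>^2 = c2 + c3 * (2 * x + s2)" "2 * \<mu> * n0 = c1 - c3 * (x^2 + 2 * x * s2)"
      "n0^2 = c0 + c3 * x^2 * s2"
    using t(1) by (simp_all add: line_section_iff power2_eq_square algebra_simps)
  obtain s where diff: "A \<ominus> B = (Fin s, (v * (x - s) + y * (u - s)) / (x - u))"
    and s: "polar s x u = - 2 * y * v"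
    using polar_diff[of x u y v] xu A' B' by auto
  obtain r where sum: "A \<oplus> B = (Fin r, (- v * (x - r) + y * (u - r)) / (x - u))"
    and r: "polar r x u = 2 * y * v"
    using polar_diff[of x u y "- v"] xu A' B' by auto
  \<comment> \<open>\<open>h\<^sup>2\<close> times the quadratic factor that remains after \<open>z - s2\<close> is split off.\<close>
  define q where "q z = c3 * h^2 * (z - x)^2 - 4 * y * h * (\<mu> * z + n0) - 4 * y^2 * (z - s2)" for z
  have "(polar z x u)^2 - 4 * y^2 * v^2 = c3 * h^2 * q z" for z
    using c t(2) unfolding A'(2) B'(2) q_def polar_def poly_J h_def by algebra
  moreover have "(polar z x u)^2 - 4 * y^2 * v^2 = c3^2 * h^4 * ((z - s) * (z - r))" for z
  proof -
    have "polar z x u + 2 * y * v = - c3 * (z - s) * h^2" "polar z x u - 2 * y * v = - c3 * (z - r) * h^2"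
      using s r by (simp add: polar_affine[of z x u s] h_def power2_commute)
        (simp add: r polar_affine[of z x u r] h_def power2_commute)
    then show ?thesis by algebra
  qed
  ultimately have "c3 * h^2 * q z = c3 * h^2 * (c3 * h^2 * ((z - s) * (z - r)))" for z
    by (simp add: power2_eq_square power4_eq_xxxx mult.assoc)
  then have q: "q z = c3 * h^2 * ((z - s) * (z - r))" for z
    using c3_nonzero xu by (simp add: h_def)
  have line_sec: "line_section m n s r s2"
    unfolding line_section_def
  proof
    fix z
    have "poly J z = (\<mu> * z + n0)^2 + c3 * (z - x)^2 * (z - s2)"
      using t(1)[unfolded line_section_def, rule_format, of z] by (simp add: power2_eq_square algebra_simps)
    moreover have "h * (2 * y / h) = 2 * y" using xu by (simp add: h_def)
    ultimately have "h^2 * (poly J z - (m * z + n)^2) = (z - s2) * q z"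
      unfolding line q_def by algebra
    then show "poly J z - (m * z + n)^2 = c3 * (z - s) * (z - r) * (z - s2)"
      unfolding q using xu by (simp add: h_def)
  qed
  have on_line: "(w * (x - z) + y * (u - z)) / (x - u) = m * z + n"
    if "polar z x u = - 2 * y * w" "q z = 0" for w z
  proof -
    have "y * (w * (x - z) + y * (u - z)) = y * (- h * (\<mu> * z + n0) - 2 * y * (z - s2))"
      using that(1) that(2)[unfolded q_def] c t(2) A'(2) unfolding polar_def poly_J h_def by algebra
    then have "w * (x - z) + y * (u - z) = - h * (\<mu> * z + n0) - 2 * y * (z - s2)"
      using y by simp
    moreover have "h * (2 * y / h) = 2 * y" using xu by (simp add: h_def)
    ultimately have "w * (x - z) + y * (u - z) = (m * z + n) * (x - u)"
      unfolding line h_def by algebra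
    then show ?thesis using xu by simp
  qed
  have "A \<ominus> B = (Fin s, m * s + n)" "A \<oplus> B = (Fin r, m * r + n)"
    using on_line[of s v] on_line[of r "- v"] q[of s] q[of r] r s unfolding sum diff by simp_all
  moreover have "m * s2 + n = \<mu> * s2 + n0"
    unfolding line by simp
  ultimately show ?thesis
    unfolding double using collinear_add[OF line_sec] by simp
qed

text \<open>
  The coincidences among the abscissae of \<open>A\<close>, \<open>B\<close>, \<open>C\<close> are trivial, or follow from
  \<open>diff_add_sum\<close> by the cancellation laws.
\<close>
theorem diff_add_diff:
  assumes A: "A \<in> E" and B: "B \<in> E" and C: "C \<in> E"
  shows "(A \<ominus> B) \<oplus> (B \<ominus> C) = A \<ominus> C"
proof (cases "A = \<O> \<or> B = \<O> \<or> C = \<O>")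
  case True
  then consider "A = \<O>" | "B = \<O>" | "C = \<O>" by blast
  then show ?thesis
  proof cases
    case 1
    have "ell_neg B \<oplus> (B \<ominus> C) = (B \<ominus> C) \<ominus> B"
      using B C by (intro add_commute) simp_all
    also have "\<dots> = (ell_neg C \<oplus> B) \<ominus> B"
      using add_commute[of B "ell_neg C"] B C by simp
    also have "\<dots> = ell_neg C" using B C by (simp add: add_diff_cancel)
    finally show ?thesis using 1 by simp
  next
    case 2
    then show ?thesis using A C by simp
  next
    case 3
    then show ?thesis using A B by (simp add: diff_add_cancel)
  qed
next
  case False
  obtain x1 y1 where A': "A = (Fin x1, y1)" "y1^2 = poly J x1" using A False by (auto elim: E_cases)
  obtain x2 y2 where B': "B = (Fin x2, y2)" "y2^2 = poly J x2" using B False by (auto elim: E_cases)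
  obtain x3 y3 where C': "C = (Fin x3, y3)" "y3^2 = poly J x3" using C False by (auto elim: E_cases)
  show ?thesis
  proof (cases "x1 = x2 \<or> x2 = x3 \<or> x3 = x1")
    case False
    then show ?thesis using diff_add_diff_distinct A' B' C' by simp
  next
    case True
    then consider "A = B" | "B = C" | "A = C" | "B = ell_neg A" | "C = ell_neg B" | "C = ell_neg A"
      using curve_fst_eq A B C A' B' C' by (metis fst_conv)
    then show ?thesis
    proof cases
      case 1
      then show ?thesis using A C by simp
    next
      case 2
      then show ?thesis using A C by simp
    next
      case 3
      have "(A \<ominus> B) \<oplus> ell_neg (A \<ominus> B) = \<O>" using A B by simp
      moreover have "ell_neg (A \<ominus> B) = B \<ominus> A"
        using A B add_commute[of B "ell_neg A"] by (simp add: neg_add)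
      ultimately show ?thesis using 3 A by simp
    next
      case 4
      have "(A \<oplus> A) \<oplus> ell_neg (A \<oplus> C) = ((A \<ominus> C) \<oplus> (A \<oplus> C)) \<ominus> (A \<oplus> C)"
        using A C by (simp add: diff_add_sum)
      also have "\<dots> = A \<ominus> C" using A C by (intro add_diff_cancel) simp_all
      finally show ?thesis using 4 A C by (simp add: neg_add)
    next
      case 5
      have "(A \<ominus> B) \<oplus> (B \<oplus> B) = (B \<oplus> B) \<ominus> (B \<ominus> A)"
        using A B add_commute[of "A \<ominus> B" "B \<oplus> B"] add_commute[of A "ell_neg B"] by (simp add: neg_add)
      moreover have "B \<oplus> B = (B \<oplus> A) \<oplus> (B \<ominus> A)"
        using A B diff_add_sum[of B A] add_commute[of "B \<ominus> A" "B \<oplus> A"] by simp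
      moreover have "((B \<oplus> A) \<oplus> (B \<ominus> A)) \<ominus> (B \<ominus> A) = B \<oplus> A"
        using A B by (intro add_diff_cancel) simp_all
      ultimately show ?thesis using 5 A B add_commute[of A B] by simp
    next
      case 6
      have "(A \<ominus> B) \<oplus> (B \<oplus> A) = A \<oplus> A"
        using A B diff_add_sum[of A B] add_commute[of A B] by simp
      then show ?thesis using 6 by simp
    qed
  qed
qed

text \<open>
  The identity \<open>diff_add_diff\<close> for the triple \<open>A + (B + C)\<close>, \<open>B + C\<close>, \<open>C\<close>.
\<close>
theorem add_assoc:
  assumes A: "A \<in> E" and B: "B \<in> E" and C: "C \<in> E"
  shows "(A \<oplus> B) \<oplus> C = A \<oplus> (B \<oplus> C)"
proof -
  have "A \<oplus> B = ((A \<oplus> (B \<oplus> C)) \<ominus> (B \<oplus> C)) \<oplus> ((B \<oplus> C) \<ominus> C)"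
    using assms by (simp add: add_diff_cancel)
  also have "\<dots> = (A \<oplus> (B \<oplus> C)) \<ominus> C"
    using assms by (intro diff_add_diff) simp_all
  finally show ?thesis using assms by (simp add: diff_add_cancel)
qed

end

section \<open>Two-valued addition as a symmetric form\<close>

text \<open>
  Eliminating \<open>m\<close> and \<open>n\<close> from the three coefficient conditions \<open>line_section_iff\<close> leaves
  \<open>(c1 - c3 e2)\<^sup>2 = 4 (c2 + c3 e1) (c0 + c3 e3)\<close> with the elementary symmetric functions of the
  abscissae.  This is the homogeneous form of that condition, quadratic in each argument.
\<close>
definition addition_form ::
    "complex poly \<Rightarrow> complex \<times> complex \<Rightarrow> complex \<times> complex \<Rightarrow> complex \<times> complex \<Rightarrow> complex" where
  "addition_form J = (\<lambda>(p1, p0) (q1, q0) (r1, r0).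
     let e0 = p0 * q0 * r0; e1 = p1 * q0 * r0 + p0 * q1 * r0 + p0 * q0 * r1;
         e2 = p1 * q1 * r0 + p1 * q0 * r1 + p0 * q1 * r1; e3 = p1 * q1 * r1
     in (coeff J 1 * e0 - coeff J 3 * e2)^2
        - 4 * (coeff J 2 * e0 + coeff J 3 * e1) * (coeff J 0 * e0 + coeff J 3 * e3))"

lemma addition_form_perm:
  "addition_form J p q r = addition_form J q p r" "addition_form J p q r = addition_form J p r q"
  by (auto simp: addition_form_def Let_def mult_ac add_ac split: prod.split)

lemma addition_form_scale:
  "addition_form J p q (k * r1, k * r0) = k^2 * addition_form J p q (r1, r0)"
  by (simp add: addition_form_def Let_def power2_eq_square algebra_simps split: prod.split)

definition wedge :: "complex \<times> complex \<Rightarrow> complex \<times> complex \<Rightarrow> complex" where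
  "wedge p q = fst p * snd q - snd p * fst q"

context smooth_cubic begin

text \<open>
  As a binary quadratic form in \<open>r\<close>, the addition form at the classes of \<open>A\<close> and \<open>B\<close> has the two
  values of the two-valued sum as its zeros, with multiplicity.  The constant is not zero even if
  \<open>A\<close> and \<open>B\<close> are the same point of order two: there it is the square of \<open>J'\<close>.
\<close>
lemma addition_form_factor:
  assumes A: "A \<in> E" and B: "B \<in> E"
  shows "\<exists>k. k \<noteq> 0 \<and> (\<forall>r. addition_form J (hom_coords (fst A)) (hom_coords (fst B)) r =
    k * wedge r (hom_coords (fst (A \<oplus> B))) * wedge r (hom_coords (fst (A \<ominus> B))))"
proof -
  consider "A = \<O>" | "B = \<O>" | "A \<noteq> \<O>" "B \<noteq> \<O>" by blast
  then show ?thesis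
  proof cases
    case 1
    show ?thesis
      using c3_nonzero unfolding 1
      by (cases "fst B"; intro exI[of _ "c3^2"])
        (auto simp: addition_form_def Let_def wedge_def power2_eq_square algebra_simps)
  next
    case 2
    then show ?thesis
      using c3_nonzero A
      by (cases "fst A"; intro exI[of _ "c3^2"])
        (auto simp: addition_form_def Let_def wedge_def power2_eq_square algebra_simps)
  next
    case 3
    obtain x y where A': "A = (Fin x, y)" "y^2 = poly J x" using A 3 by (auto elim: E_cases)
    obtain u v where B': "B = (Fin u, v)" "v^2 = poly J u" using B 3 by (auto elim: E_cases)
    show ?thesis
    proof (cases "x = u")
      case False
      define D where "D = (x - u)^2"
      have D: "D \<noteq> 0" using False by (simp add: D_def)
      obtain s where diff: "A \<ominus> B = (Fin s, (v * (x - s) + y * (u - s)) / (x - u))"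
        and s: "polar s x u = - 2 * y * v"
        using polar_diff[of x u y v] False A' B' by auto
      obtain r where sum: "A \<oplus> B = (Fin r, (- v * (x - r) + y * (u - r)) / (x - u))"
        and r: "polar r x u = 2 * y * v"
        using polar_diff[of x u y "- v"] False A' B' by auto
      have p: "polar 0 x u + 2 * y * v = c3 * D * s" "polar 0 x u - 2 * y * v = c3 * D * r"
        using s r by (simp add: polar_affine[of s x u 0] D_def algebra_simps)
          (use r in \<open>simp add: polar_affine[of r x u 0] D_def algebra_simps\<close>)
      have "addition_form J (x, 1) (u, 1) (r1, r0) = c3^2 * D * (r1 - s * r0) * (r1 - r * r0)" for r1 r0
      proof -
        have "D * addition_form J (x, 1) (u, 1) (r1, r0) =
            (polar 0 x u * r0 - c3 * D * r1)^2 - 4 * poly J x * poly J u * r0^2"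
          unfolding addition_form_def Let_def prod.case polar_def poly_J D_def by algebra
        also have "\<dots> = D * (c3^2 * D * (r1 - s * r0) * (r1 - r * r0))"
          using p unfolding A'(2)[symmetric] B'(2)[symmetric] by algebra
        finally show ?thesis using D by simp
      qed
      then show ?thesis
        using D c3_nonzero by (intro exI[of _ "c3^2 * D"])
          (auto simp: A'(1) B'(1) sum[unfolded A' B'] diff[unfolded A' B', simplified] wedge_def algebra_simps)
    next
      case True
      show ?thesis
      proof (cases "y = 0")
        case y: True
        then have v: "v = 0" using A' B' True by simp
        have J: "poly J x = 0" using A'(2) y by simp
        have "addition_form J (x, 1) (x, 1) (r1, r0) = (poly (pderiv J) x)^2 * r0^2" for r1 r0
          using J unfolding addition_form_def Let_def prod.case poly_J poly_pderiv_J by algebra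
        then show ?thesis
          using smooth[OF J] by (intro exI[of _ "(poly (pderiv J) x)^2"])
            (auto simp: A'(1) B'(1) v y True[symmetric] wedge_def power2_eq_square ell_add.simps(3))
      next
        case y: False
        obtain \<mu> n0 s2 where t: "line_section \<mu> n0 x x s2" "y = \<mu> * x + n0"
          using line_through[OF A'(2,2)] y by (metis add_eq_0_iff2 mult_2 mult_eq_0_iff zero_neq_numeral)
        have double: "A \<oplus> A = (Fin s2, - (\<mu> * s2 + n0))"
          unfolding A' t(2) by (rule collinear_add[OF t(1)])
        have c: "\<mu>^2 = c2 + c3 * (2 * x + s2)" "2 * \<mu> * n0 = c1 - c3 * (x^2 + 2 * x * s2)"
          "n0^2 = c0 + c3 * x^2 * s2"
          using t(1) by (simp_all add: line_section_iff power2_eq_square algebra_simps)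
        have form: "addition_form J (x, 1) (x, 1) (r1, r0) = - 4 * c3 * y^2 * r0 * (r1 - s2 * r0)" for r1 r0
          using c t(2) unfolding addition_form_def Let_def prod.case by algebra
        have "B = A \<or> B = ell_neg A" using curve_fst_eq[OF A B] A' B' True by simp
        then have "{fst (A \<oplus> B), fst (A \<ominus> B)} = {Fin s2, Infty}"
          using A double by auto
        then have "wedge r (hom_coords (fst (A \<oplus> B))) * wedge r (hom_coords (fst (A \<ominus> B))) =
            wedge r (s2, 1) * wedge r (1, 0)" for r
          by (auto simp: doubleton_eq_iff)
        then show ?thesis
          using y c3_nonzero by (intro exI[of _ "4 * c3 * y^2"])
            (auto simp: mult.assoc, auto simp: A'(1) B'(1) True[symmetric] form wedge_def algebra_simps)
      qed
    qed
  qed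
qed

end

section \<open>The tangents of the second conic as classes of points\<close>

definition hom_polar ::
    "complex poly \<Rightarrow> complex \<Rightarrow> complex \<times> complex \<Rightarrow> complex \<times> complex \<Rightarrow> complex" where
  "hom_polar J z = (\<lambda>(x1, x0) (y1, y0).
     coeff J 3 * x1 * y1 * (x1 * y0 + x0 * y1) + 2 * coeff J 2 * x1 * y1 * x0 * y0
     + coeff J 1 * x0 * y0 * (x1 * y0 + x0 * y1) + 2 * coeff J 0 * x0^2 * y0^2
     - coeff J 3 * z * (x1 * y0 - x0 * y1)^2)"

text \<open>
  Up to sign the determinant of \<open>pencil_matrix a (Fin s)\<close>, as a polynomial in \<open>s\<close>.
\<close>
definition resolvent_cubic :: "(nat \<Rightarrow> complex) \<Rightarrow> complex poly" where
  "resolvent_cubic a = [: a 0 * (a 3)^2 + (a 1)^2 * a 4 + a 2 * (a 5)^2 - a 0 * a 2 * a 4 - 2 * a 1 * a 3 * a 5,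
      (a 5)^2 - 4 * a 2 * a 5 + 4 * a 1 * a 3 - a 0 * a 4, 4 * a 2 - 4 * a 5, 4:]"

text \<open>
  The bilinear form of the tangential equation of the conic with parameter \<open>s\<close>, evaluated at the
  tangents to \<open>C\<^sub>2\<close> with homogeneous parameters \<open>x\<close> and \<open>y\<close>.
\<close>
definition dual_form ::
    "(nat \<Rightarrow> complex) \<Rightarrow> complex \<Rightarrow> complex \<times> complex \<Rightarrow> complex \<times> complex \<Rightarrow> complex" where
  "dual_form a s = (\<lambda>(x1, x0) (y1, y0).
     a 0 * x1^2 * y1^2 - 2 * a 1 * x1 * y1 * (x1 * y0 + x0 * y1) + 4 * (a 2 + s) * x1 * y1 * x0 * y0
     + (a 5 - 2 * s) * (x1^2 * y0^2 + x0^2 * y1^2) - 2 * a 3 * x0 * y0 * (x1 * y0 + x0 * y1) + a 4 * x0^2 * y0^2)"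

text \<open>
  Four times \<open>F\<close> in homogeneous parameters, see \<open>F_darboux_form\<close>; the factor clears the halves.
\<close>
definition darboux_form ::
    "(nat \<Rightarrow> complex) \<Rightarrow> complex \<Rightarrow> complex \<times> complex \<Rightarrow> complex \<times> complex \<Rightarrow> complex" where
  "darboux_form a s = (\<lambda>(x1, x0) (y1, y0).
     let z1 = x0 * y0; z2 = x1 * y0 + x0 * y1; z3 = x1 * y1; b = a 2 + s; m = a 5 - 2 * s
     in 4 * z1^2 * ((a 3)^2 - b * a 4) + z2^2 * (m^2 - a 0 * a 4) + 4 * z3^2 * ((a 1)^2 - a 0 * b)
        + 4 * z1 * z2 * (a 1 * a 4 - m * a 3) - 8 * z1 * z3 * (a 1 * a 3 - m * b)
        + 4 * z2 * z3 * (a 0 * a 3 - a 1 * m))"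

text \<open>
  The coefficients of \<open>C\<^sub>1\<close> after the translation of the Darboux coordinate by \<open>e\<close>.  Entry 4 is the
  value at \<open>e\<close> of the quartic whose zeros are the common tangents, entry 3 is its derivative
  there divided by \<open>-4\<close>.
\<close>
definition shift_coeffs :: "(nat \<Rightarrow> complex) \<Rightarrow> complex \<Rightarrow> nat \<Rightarrow> complex" where
  "shift_coeffs a e = ((!) [a 0, a 1 - a 0 * e, a 2 - 2 * a 1 * e + a 0 * e^2,
     a 3 - (2 * a 2 + a 5) * e + 3 * a 1 * e^2 - a 0 * e^3,
     a 4 - 4 * a 3 * e + (4 * a 2 + 2 * a 5) * e^2 - 4 * a 1 * e^3 + a 0 * e^4,
     a 5 - 2 * a 1 * e + a 0 * e^2])"

lemma shift_coeffs_simps: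
  "shift_coeffs a e 0 = a 0" "shift_coeffs a e (Suc 0) = a 1 - a 0 * e"
  "shift_coeffs a e 1 = a 1 - a 0 * e"
  "shift_coeffs a e 2 = a 2 - 2 * a 1 * e + a 0 * e^2"
  "shift_coeffs a e 3 = a 3 - (2 * a 2 + a 5) * e + 3 * a 1 * e^2 - a 0 * e^3"
  "shift_coeffs a e 4 = a 4 - 4 * a 3 * e + (4 * a 2 + 2 * a 5) * e^2 - 4 * a 1 * e^3 + a 0 * e^4"
  "shift_coeffs a e 5 = a 5 - 2 * a 1 * e + a 0 * e^2"
  by (simp_all add: shift_coeffs_def eval_nat_numeral)

lemma resolvent_cubic_shift: "resolvent_cubic (shift_coeffs a e) = resolvent_cubic a"
  by (simp add: resolvent_cubic_def shift_coeffs_simps power2_eq_square power3_eq_cube power4_eq_xxxx algebra_simps)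

lemma dual_form_shift:
  "dual_form (shift_coeffs a e) s (x1 - e * x0, x0) (y1 - e * y0, y0) = dual_form a s (x1, x0) (y1, y0)"
  unfolding dual_form_def prod.case shift_coeffs_simps by algebra

lemma coeff_resolvent_cubic:
  "coeff (resolvent_cubic a) 0 = a 0 * (a 3)^2 + (a 1)^2 * a 4 + a 2 * (a 5)^2 - a 0 * a 2 * a 4 - 2 * a 1 * a 3 * a 5"
  "coeff (resolvent_cubic a) 1 = (a 5)^2 - 4 * a 2 * a 5 + 4 * a 1 * a 3 - a 0 * a 4"
  "coeff (resolvent_cubic a) 2 = 4 * a 2 - 4 * a 5" "coeff (resolvent_cubic a) 3 = 4"
  by (simp_all add: resolvent_cubic_def coeff_pCons numeral_2_eq_2 numeral_3_eq_3)

text \<open>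
  If \<open>x = 0\<close> is a common tangent, then \<open>x \<mapsto> (b\<^sub>5 x - 2 b\<^sub>3) / (2 x)\<close> carries the pencil of
  conics into the pencil of polarizations of its own resolvent cubic.
\<close>
lemma hom_polar_dual_form:
  assumes "b 4 = 0"
  shows "hom_polar (resolvent_cubic b) s (b 5 * x1 - 2 * b 3 * x0, 2 * x1) (b 5 * y1 - 2 * b 3 * y0, 2 * y1) =
    32 * (b 3)^2 * dual_form b s (x1, x0) (y1, y0)"
  unfolding hom_polar_def dual_form_def prod.case coeff_resolvent_cubic assms by algebra

lemma addition_form_darboux_form:
  assumes "b 4 = 0"
  shows "addition_form (resolvent_cubic b) (s, 1) (b 5 * x1 - 2 * b 3 * x0, 2 * x1) (b 5 * y1 - 2 * b 3 * y0, 2 * y1) =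
    64 * (b 3)^2 * darboux_form b s (x1, x0) (y1, y0)"
  unfolding addition_form_def darboux_form_def prod.case coeff_resolvent_cubic assms Let_def
    mult_zero_left mult_zero_right mult_1 add_0_right diff_0_right diff_0 by algebra

lemma darboux_form_shift:
  "darboux_form (shift_coeffs a e) s (x1 - e * x0, x0) (y1 - e * y0, y0) = darboux_form a s (x1, x0) (y1, y0)"
  unfolding darboux_form_def prod.case shift_coeffs_simps Let_def by algebra


lemma F_darboux_form: "4 * F a (Fin s) x y = darboux_form a s (hom_coords x) (hom_coords y)"
proof -
  obtain x1 x0 y1 y0 where h: "hom_coords x = (x1, x0)" "hom_coords y = (y1, y0)"
    by (cases "hom_coords x"; cases "hom_coords y")
  show ?thesis
    unfolding F_def point_form_expand meet_def h darboux_form_def prod.case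
    by (simp add: Let_def power2_eq_square field_simps)
qed

lemma F_Infty: "F a Infty x y = (wedge (hom_coords x) (hom_coords y))^2"
proof -
  obtain x1 x0 y1 y0 where h: "hom_coords x = (x1, x0)" "hom_coords y = (y1, y0)"
    by (cases "hom_coords x"; cases "hom_coords y")
  show ?thesis
    unfolding F_def point_form_expand meet_def h prod.case
    by (simp add: Let_def wedge_def power2_eq_square field_simps)
qed

lemma pencil_form_tangents:
  "pencil_form a (Fin s) (\<alpha> *s tangent_line x + \<beta> *s tangent_line y) =
    \<alpha>^2 * dual_form a s (hom_coords x) (hom_coords x)
    + 2 * \<alpha> * \<beta> * dual_form a s (hom_coords x) (hom_coords y)
    + \<beta>^2 * dual_form a s (hom_coords y) (hom_coords y)"
  by (cases x; cases y)
    (simp_all add: C1_form_def C2_form_def dual_form_def power2_eq_square algebra_simps)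

lemma pencil_form_tangent: "pencil_form a (Fin s) (tangent_line x) = dual_form a 0 (hom_coords x) (hom_coords x)"
  by (cases x) (simp_all add: C1_form_def C2_form_def dual_form_def power2_eq_square algebra_simps)

lemma common_tangent_iff: "common_tangent a x \<longleftrightarrow> dual_form a 0 (hom_coords x) (hom_coords x) = 0"
proof -
  have "pencil_form a K (tangent_line x) = 0"
    if "dual_form a 0 (hom_coords x) (hom_coords x) = 0" for K
  proof (cases K)
    case (Fin s)
    then show ?thesis using that pencil_form_tangent[of a s x] by simp
  qed (simp add: tangent_line_tangent)
  then show ?thesis unfolding common_tangent_def using pencil_form_tangent by metis
qed

definition of_hom :: "complex \<times> complex \<Rightarrow> cp1" where
  "of_hom p = (if snd p = 0 then Infty else Fin (fst p / snd p))"

lemma of_hom: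
  assumes "p \<noteq> (0, 0)"
  obtains k where "k \<noteq> 0" "p = (k * fst (hom_coords (of_hom p)), k * snd (hom_coords (of_hom p)))"
  using assms that[of "fst p"] that[of "snd p"]
  by (cases p; cases "snd p = 0") (auto simp: of_hom_def)

lemma hom_coords_nonzero [simp]: "hom_coords x \<noteq> (0, 0)"
  by (cases x) auto

lemma wedge_eq_0_iff [simp]: "wedge (hom_coords x) (hom_coords y) = 0 \<longleftrightarrow> x = y"
  by (cases x; cases y) (auto simp: wedge_def)

lemma wedge_scale [simp]: "wedge p (k * q1, k * q0) = k * wedge p (q1, q0)"
  "wedge (k * p1, k * p0) q = k * wedge (p1, p0) q"
  by (simp_all add: wedge_def algebra_simps)

lemma wedge_of_hom:
  assumes "p \<noteq> (0, 0)"
  shows "wedge (hom_coords (of_hom p)) q = 0 \<longleftrightarrow> wedge p q = 0"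
proof -
  obtain k where "k \<noteq> 0" "p = (k * fst (hom_coords (of_hom p)), k * snd (hom_coords (of_hom p)))"
    using of_hom[OF assms] .
  then have "wedge p q = k * wedge (hom_coords (of_hom p)) q"
    by (metis wedge_scale(2) prod.collapse)
  then show ?thesis using \<open>k \<noteq> 0\<close> by simp
qed

lemma quadratic_roots_factored:
  assumes "k \<noteq> 0" "\<And>y. f y = k * wedge (y, 1) (hom_coords p) * wedge (y, 1) (hom_coords q)"
  shows "quadratic_roots (as_poly f) = {#p, q#}"
proof (cases p; cases q)
  fix u v assume pq: "p = Fin u" "q = Fin v"
  define g where "g = [:- u, 1:] * [:- v, 1:]"
  have "as_poly f = smult k g"
    by (rule as_poly_eqI) (simp add: assms(2) pq wedge_def g_def algebra_simps)
  moreover have "proots g = {#u, v#}"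
    unfolding g_def by (subst proots_mult) auto
  moreover have "degree g = 2" by (simp add: g_def)
  ultimately show ?thesis using assms(1) by (simp add: quadratic_roots_def pq)
next
  fix u assume pq: "p = Fin u" "q = Infty"
  have "as_poly f = smult (- k) [:- u, 1:]"
    by (rule as_poly_eqI) (simp add: assms(2) pq wedge_def algebra_simps)
  then show ?thesis using assms(1) by (simp add: quadratic_roots_def pq del: smult_pCons)
next
  fix u assume pq: "p = Infty" "q = Fin u"
  have "as_poly f = smult (- k) [:- u, 1:]"
    by (rule as_poly_eqI) (simp add: assms(2) pq wedge_def algebra_simps)
  then show ?thesis using assms(1) by (simp add: quadratic_roots_def pq del: smult_pCons)
next
  assume pq: "p = Infty" "q = Infty"
  have "as_poly f = [:k:]"
    by (rule as_poly_eqI) (simp add: assms(2) pq wedge_def algebra_simps)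
  then show ?thesis using assms(1) by (simp add: quadratic_roots_def pq numeral_2_eq_2)
qed

text \<open>
  By Cramer's rule: the determinant of the three equations is a product of wedges.
\<close>
lemma binary_quadratic_three_zeros:
  assumes "\<And>i. i \<in> {x, y, z} \<Longrightarrow> (case hom_coords i of (u, v) \<Rightarrow> q2 * u^2 + q1 * u * v + q0 * v^2) = 0"
    and "x \<noteq> y" "y \<noteq> z" "x \<noteq> z"
  shows "q2 = 0 \<and> q1 = 0 \<and> q0 = (0::complex)"
proof -
  obtain x1 x0 y1 y0 z1 z0 where h: "hom_coords x = (x1, x0)" "hom_coords y = (y1, y0)" "hom_coords z = (z1, z0)"
    by (cases "hom_coords x"; cases "hom_coords y"; cases "hom_coords z")
  have d: "x1 * y0 - x0 * y1 \<noteq> 0" "y1 * z0 - y0 * z1 \<noteq> 0" "x1 * z0 - x0 * z1 \<noteq> 0"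
    using assms(2-4) h unfolding wedge_eq_0_iff[symmetric] by (simp_all add: wedge_def)
  have e: "q2 * x1^2 + q1 * x1 * x0 + q0 * x0^2 = 0" "q2 * y1^2 + q1 * y1 * y0 + q0 * y0^2 = 0"
    "q2 * z1^2 + q1 * z1 * z0 + q0 * z0^2 = 0"
    using assms(1)[of x] assms(1)[of y] assms(1)[of z] h by simp_all
  define D where "D = (x1 * y0 - x0 * y1) * (y1 * z0 - y0 * z1) * (x1 * z0 - x0 * z1)"
  have "D * q2 = 0" "D * q1 = 0" "D * q0 = 0" using e unfolding D_def by algebra+
  then show ?thesis using d by (simp add: D_def)
qed

text \<open>
  Fix a finite common tangent \<open>e\<close>.  As a polynomial in \<open>s\<close>, \<open>F s e x\<close> has discriminant 0, so only
  one conic of the pencil passes through the intersection of the tangents \<open>e\<close> and \<open>x\<close>.  Its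
  parameter is a fractional linear function of \<open>x\<close>, which is given here on homogeneous coordinates.
\<close>
definition weierstrass_map :: "(nat \<Rightarrow> complex) \<Rightarrow> complex \<Rightarrow> complex \<times> complex \<Rightarrow> complex \<times> complex" where
  "weierstrass_map a e = (\<lambda>(x1, x0). (shift_coeffs a e 5 * (x1 - e * x0) - 2 * shift_coeffs a e 3 * x0, 2 * (x1 - e * x0)))"

text \<open>
  The adjoint for \<open>wedge\<close>, hence the inverse map up to a scalar.
\<close>
definition weierstrass_adj :: "(nat \<Rightarrow> complex) \<Rightarrow> complex \<Rightarrow> complex \<times> complex \<Rightarrow> complex \<times> complex" where
  "weierstrass_adj a e = (\<lambda>(y1, y0). (e * (shift_coeffs a e 5 * y0 - 2 * y1) + 2 * shift_coeffs a e 3 * y0,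
     shift_coeffs a e 5 * y0 - 2 * y1))"

lemma wedge_weierstrass: "wedge (weierstrass_map a e p) q = wedge p (weierstrass_adj a e q)"
  by (simp add: wedge_def weierstrass_map_def weierstrass_adj_def algebra_simps split: prod.split)

lemma wedge_weierstrass_weierstrass: "wedge (weierstrass_map a e p) (weierstrass_map a e q) = 4 * shift_coeffs a e 3 * wedge p q"
  by (simp add: wedge_def weierstrass_map_def algebra_simps split: prod.split)

locale based_pencil =
  fixes a :: "nat \<Rightarrow> complex" and e :: complex
  assumes base: "shift_coeffs a e 4 = 0" and simple: "shift_coeffs a e 3 \<noteq> 0"
begin

definition \<phi> where "\<phi> x = of_hom (weierstrass_map a e (hom_coords x))"
definition \<psi> where "\<psi> y = of_hom (weierstrass_adj a e (hom_coords y))"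

lemma weierstrass_nonzero: "p \<noteq> (0, 0) \<Longrightarrow> weierstrass_map a e p \<noteq> (0, 0)"
  using simple by (auto simp: weierstrass_map_def split: prod.splits)

lemma weierstrass_adj_nonzero: "p \<noteq> (0, 0) \<Longrightarrow> weierstrass_adj a e p \<noteq> (0, 0)"
  using simple by (auto simp: weierstrass_adj_def split: prod.splits)

lemma phi_scale:
  obtains k where "k \<noteq> 0"
    "weierstrass_map a e (hom_coords x) = (k * fst (hom_coords (\<phi> x)), k * snd (hom_coords (\<phi> x)))"
  using of_hom[OF weierstrass_nonzero[OF hom_coords_nonzero]] unfolding \<phi>_def by blast

lemma psi_scale:
  obtains k where "k \<noteq> 0"
    "weierstrass_adj a e (hom_coords x) = (k * fst (hom_coords (\<psi> x)), k * snd (hom_coords (\<psi> x)))"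
  using of_hom[OF weierstrass_adj_nonzero[OF hom_coords_nonzero]] unfolding \<psi>_def by blast

lemma phi_psi [simp]: "\<phi> (\<psi> y) = y"
proof -
  obtain k where k: "k \<noteq> 0"
    "weierstrass_adj a e (hom_coords y) = (k * fst (hom_coords (\<psi> y)), k * snd (hom_coords (\<psi> y)))"
    using psi_scale .
  have "wedge (weierstrass_map a e (hom_coords (\<psi> y))) (hom_coords y) = 0"
    by (simp add: wedge_weierstrass k(2))
  then show ?thesis
    using wedge_of_hom[OF weierstrass_nonzero[OF hom_coords_nonzero]] unfolding \<phi>_def wedge_eq_0_iff[symmetric]
    by blast
qed

lemma phi_inj [simp]: "\<phi> x = \<phi> y \<longleftrightarrow> x = y"
proof
  assume eq: "\<phi> x = \<phi> y"
  obtain k l where "k \<noteq> 0" "weierstrass_map a e (hom_coords x) = (k * fst (hom_coords (\<phi> x)), k * snd (hom_coords (\<phi> x)))"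
    "l \<noteq> 0" "weierstrass_map a e (hom_coords y) = (l * fst (hom_coords (\<phi> y)), l * snd (hom_coords (\<phi> y)))"
    using phi_scale by metis
  then have "wedge (weierstrass_map a e (hom_coords x)) (weierstrass_map a e (hom_coords y)) = 0"
    using eq by (simp add: wedge_def)
  then show "x = y" using simple by (simp add: wedge_weierstrass_weierstrass)
qed simp

lemma hom_polar_weierstrass:
  "hom_polar (resolvent_cubic a) s (weierstrass_map a e p) (weierstrass_map a e q) = 32 * (shift_coeffs a e 3)^2 * dual_form a s p q"
proof -
  obtain x1 x0 y1 y0 where h: "p = (x1, x0)" "q = (y1, y0)" by (cases p; cases q)
  show ?thesis
    using hom_polar_dual_form[of "shift_coeffs a e", OF base, of s "x1 - e * x0" x0 "y1 - e * y0" y0]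
    unfolding dual_form_shift resolvent_cubic_shift by (simp add: h weierstrass_map_def)
qed

text \<open>
  The bridge between the pencil and the cubic: in the coordinate \<open>weierstrass_map\<close>, the equation of the
  pencil in Darboux coordinates is the addition form of the resolvent cubic.
\<close>
lemma addition_form_weierstrass:
  "addition_form (resolvent_cubic a) (hom_coords K) (weierstrass_map a e (hom_coords x)) (weierstrass_map a e (hom_coords y)) =
    256 * (shift_coeffs a e 3)^2 * F a K x y"
proof (cases K)
  case (Fin s)
  obtain x1 x0 y1 y0 where h: "hom_coords x = (x1, x0)" "hom_coords y = (y1, y0)"
    by (cases "hom_coords x"; cases "hom_coords y")
  show ?thesis
    using addition_form_darboux_form[of "shift_coeffs a e", OF base, of s "x1 - e * x0" x0 "y1 - e * y0" y0] F_darboux_form[of a s x y]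
    unfolding darboux_form_shift resolvent_cubic_shift by (simp add: h weierstrass_map_def Fin)
next
  case Infty
  have "addition_form (resolvent_cubic a) (1, 0) p q = 16 * (wedge p q)^2" for p q
    by (simp add: addition_form_def coeff_resolvent_cubic[simplified] wedge_def power2_eq_square algebra_simps split: prod.split)
  then show ?thesis
    by (simp add: Infty wedge_weierstrass_weierstrass F_Infty power2_eq_square)
qed

lemma common_tangent_phi:
  "common_tangent a x \<longleftrightarrow> \<phi> x = Infty \<or> (\<exists>s. \<phi> x = Fin s \<and> poly (resolvent_cubic a) s = 0)"
proof -
  obtain k where k: "k \<noteq> 0"
    "weierstrass_map a e (hom_coords x) = (k * fst (hom_coords (\<phi> x)), k * snd (hom_coords (\<phi> x)))"
    using phi_scale .
  have "common_tangent a x \<longleftrightarrow> hom_polar (resolvent_cubic a) 0 (weierstrass_map a e (hom_coords x)) (weierstrass_map a e (hom_coords x)) = 0"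
    using simple by (simp add: hom_polar_weierstrass common_tangent_iff)
  also have "\<dots> \<longleftrightarrow> hom_polar (resolvent_cubic a) 0 (hom_coords (\<phi> x)) (hom_coords (\<phi> x)) = 0"
  proof -
    have "hom_polar J 0 (k * u, k * v) (k * u, k * v) = k^4 * hom_polar J 0 (u, v) (u, v)" for J u v
      by (simp add: hom_polar_def power2_eq_square power4_eq_xxxx algebra_simps)
    then show ?thesis using k by simp
  qed
  also have "\<dots> \<longleftrightarrow> \<phi> x = Infty \<or> (\<exists>s. \<phi> x = Fin s \<and> poly (resolvent_cubic a) s = 0)"
  proof -
    have "hom_polar (resolvent_cubic a) 0 (s, 1) (s, 1) = 2 * poly (resolvent_cubic a) s" for s
      by (simp add: hom_polar_def coeff_resolvent_cubic[simplified] power2_eq_square)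
        (simp add: resolvent_cubic_def power2_eq_square algebra_simps)
    moreover have "hom_polar (resolvent_cubic a) 0 (1, 0) (1, 0) = 0"
      by (simp add: hom_polar_def)
    ultimately show ?thesis by (cases "\<phi> x") simp_all
  qed
  finally show ?thesis .
qed

end

section \<open>General position and the discriminants\<close>
lemma dual_form_diagonal:
  "dual_form a 0 (x1, x0) (x1, x0) =
     shift_coeffs a e 0 * (x1 - e * x0)^4 - 4 * shift_coeffs a e 1 * (x1 - e * x0)^3 * x0
     + (4 * shift_coeffs a e 2 + 2 * shift_coeffs a e 5) * (x1 - e * x0)^2 * x0^2
     - 4 * shift_coeffs a e 3 * (x1 - e * x0) * x0^3 + shift_coeffs a e 4 * x0^4"
  unfolding dual_form_def prod.case shift_coeffs_simps by algebra

lemma infinite_range_Fin: "infinite (range Fin)"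
  by (metis cp1.inject finite_imageD infinite_UNIV_char_0 injI)

text \<open>
  One of the four common tangents has a finite parameter \<open>e\<close>, and \<open>e\<close> is a simple zero of the quartic:
  otherwise the other three would be zeros of the remaining quadratic factor, the quartic would
  vanish, and every tangent would be common.
\<close>
lemma general_position_base:
  assumes "general_position a"
  obtains e where "shift_coeffs a e 4 = 0" "shift_coeffs a e 3 \<noteq> 0"
proof -
  define T where "T = {x. common_tangent a x}"
  have card: "card T = 4" using assms by (simp add: general_position_def T_def)
  then have fin: "finite T" by (intro card_ge_0_finite) simp
  have "\<not> T \<subseteq> {Infty}" using card card_mono[of "{Infty}" T] by auto
  then obtain e where e: "Fin e \<in> T" by (metis cp1.exhaust insertI1 subsetI)
  have base: "shift_coeffs a e 4 = 0"
    using e dual_form_diagonal[of a e 1 e] by (simp add: T_def common_tangent_iff)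
  moreover have "shift_coeffs a e 3 \<noteq> 0"
  proof
    assume zero: "shift_coeffs a e 3 = 0"
    define b where "b = shift_coeffs a e"
    define q2 q1 q0 where "q2 = b 0" and "q1 = - 4 * b 1 - 2 * e * b 0"
      and "q0 = b 0 * e^2 + 4 * b 1 * e + 4 * b 2 + 2 * b 5"
    have diag: "dual_form a 0 (x1, x0) (x1, x0) = (x1 - e * x0)^2 * (q2 * x1^2 + q1 * x1 * x0 + q0 * x0^2)" for x1 x0
      using base zero unfolding dual_form_diagonal[of a x1 x0 e] b_def[symmetric] q2_def q1_def q0_def by algebra
    have "card (T - {Fin e}) = 3" using card e fin by simp
    then obtain x y z where xyz: "T - {Fin e} = {x, y, z}" "x \<noteq> y" "y \<noteq> z" "x \<noteq> z"
      by (auto simp: card_3_iff)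
    have "q2 = 0 \<and> q1 = 0 \<and> q0 = 0"
    proof (rule binary_quadratic_three_zeros[OF _ xyz(2-4)])
      fix i assume "i \<in> {x, y, z}"
      then have i: "common_tangent a i" "i \<noteq> Fin e" using xyz(1) by (auto simp: T_def)
      obtain u v where h: "hom_coords i = (u, v)" by (cases "hom_coords i")
      have "u - e * v \<noteq> 0"
        using i(2) h unfolding wedge_eq_0_iff[symmetric] by (simp add: wedge_def mult.commute)
      then show "(case hom_coords i of (u, v) \<Rightarrow> q2 * u^2 + q1 * u * v + q0 * v^2) = 0"
        using i(1) by (simp add: common_tangent_iff h diag)
    qed
    then have "dual_form a 0 p p = 0" for p by (cases p) (simp add: diag)
    then have "T = UNIV" by (auto simp: T_def common_tangent_iff)
    moreover have "infinite (range Fin)" by (rule infinite_range_Fin)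
    ultimately show False using fin finite_subset[of "range Fin" UNIV] by simp
  qed
  ultimately show ?thesis using that by blast
qed

text \<open>
  The map \<open>\<phi>\<close> takes \<open>e\<close> to infinity and the other three common tangents to zeros of the resolvent cubic.
  A multiple zero would leave room for at most two of them.
\<close>
lemma (in based_pencil) smooth_resolvent_cubic:
  assumes "general_position a"
  shows "smooth_cubic (resolvent_cubic a)"
proof
  show deg: "degree (resolvent_cubic a) = 3" by (simp add: resolvent_cubic_def)
  fix s assume r: "poly (resolvent_cubic a) s = 0"
  show "poly (pderiv (resolvent_cubic a)) s \<noteq> 0"
  proof
    assume d: "poly (pderiv (resolvent_cubic a)) s = 0"
    define d0 d1 d2 where "d0 = coeff (resolvent_cubic a) 0" and "d1 = coeff (resolvent_cubic a) 1" and "d2 = coeff (resolvent_cubic a) 2"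
    have res: "resolvent_cubic a = [:d0, d1, d2, 4:]"
      unfolding d0_def d1_def d2_def coeff_resolvent_cubic by (simp add: resolvent_cubic_def)
    have r': "4 * s^3 + d2 * s^2 + d1 * s + d0 = 0"
      using r by (simp add: res power2_eq_square power3_eq_cube algebra_simps)
    have d': "12 * s^2 + 2 * d2 * s + d1 = 0"
      using d by (simp add: res pderiv_pCons power2_eq_square algebra_simps)
    \<comment> \<open>The third zero of a cubic \<open>4 z\<^sup>3 + d2 z\<^sup>2 + \<dots>\<close> with a double zero \<open>s\<close>.\<close>
    define w where "w = - d2 / 4 - 2 * s"
    have w: "4 * w = - d2 - 8 * s" by (simp add: w_def)
    have "poly (resolvent_cubic a) z = 4 * (z - s)^2 * (z - w)" for z
    proof -
      have "poly (resolvent_cubic a) z = 4 * z^3 + d2 * z^2 + d1 * z + d0"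
        by (simp add: res power2_eq_square power3_eq_cube algebra_simps)
      also have "\<dots> = 4 * (z - s)^2 * (z - w)" using r' d' w by algebra
      finally show ?thesis .
    qed
    then have "\<phi> ` {x. common_tangent a x} \<subseteq> {Infty, Fin s, Fin w}"
      by (auto simp: common_tangent_phi)
    then have "card (\<phi> ` {x. common_tangent a x}) \<le> card {Infty, Fin s, Fin w}"
      by (intro card_mono) auto
    also have "\<dots> \<le> 3" by (simp add: card_insert_if)
    also have "card (\<phi> ` {x. common_tangent a x}) = card {x. common_tangent a x}"
      by (intro card_image inj_onI) simp
    finally show False using assms by (simp add: general_position_def)
  qed
qed

lemma quadratic_disc_coeffs: "quadratic_disc [:q0, q1, q2:] = q1^2 - 4 * q2 * q0"
  by (simp add: quadratic_disc_def numeral_2_eq_2)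

definition tangent_quartic :: "(nat \<Rightarrow> complex) \<Rightarrow> complex poly" where
  "tangent_quartic a = [:a 4, - 4 * a 3, 4 * a 2 + 2 * a 5, - 4 * a 1, a 0:]"

lemma as_poly_F_param:
  "as_poly (\<lambda>s. F a (Fin s) (Fin x) (Fin y)) = (let z2 = (x + y) / 2; z3 = x * y in
      [: - (a 2 * a 4 - (a 3)^2) - z2^2 * (a 0 * a 4 - (a 5)^2) - z3^2 * (a 0 * a 2 - (a 1)^2)
           + 2 * z2 * (a 1 * a 4 - a 5 * a 3) - 2 * z3 * (a 1 * a 3 - a 5 * a 2)
           + 2 * z2 * z3 * (a 0 * a 3 - a 1 * a 5),
         - a 4 - 4 * a 5 * z2^2 - a 0 * z3^2 + 4 * a 3 * z2 + 2 * z3 * (a 5 - 2 * a 2)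
           + 4 * a 1 * z2 * z3,
         4 * z2^2 - 4 * z3 :])"
  by (rule as_poly_eqI)
    (simp add: F_def meet_Fin point_form_expand Let_def power2_eq_square field_simps)

lemma disc_param:
  "quadratic_disc (as_poly (\<lambda>s. F a (Fin s) (Fin x) (Fin y))) = poly (tangent_quartic a) x * poly (tangent_quartic a) y"
  unfolding as_poly_F_param Let_def quadratic_disc_coeffs tangent_quartic_def
  by (simp add: field_simps power2_eq_square)

lemma disc_point:
  "quadratic_disc (as_poly (\<lambda>y. F a (Fin s) (Fin x) (Fin y))) = poly (resolvent_cubic a) s * poly (tangent_quartic a) x"
proof -
  define b where "b = a 2 + s"
  define m where "m = a 5 - 2 * s"
  have y: "as_poly (\<lambda>y. F a (Fin s) (Fin x) (Fin y)) =
      (let A = - (b * a 4 - (a 3)^2); B = - (a 0 * a 4 - m^2); C = - (a 0 * b - (a 1)^2);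
           D = 2 * (a 1 * a 4 - m * a 3); E = - 2 * (a 1 * a 3 - m * b); G = 2 * (a 0 * a 3 - a 1 * m)
       in [: A + B * x^2 / 4 + D * x / 2, B * x / 2 + D / 2 + E * x + G * x^2 / 2,
             B / 4 + C * x^2 + G * x / 2 :])"
    unfolding b_def m_def by (rule as_poly_eqI)
      (simp add: F_def meet_Fin point_form_expand Let_def power2_eq_square field_simps)
  have "poly (tangent_quartic a) x = a 0 * x^4 - 4 * a 1 * x^3 + (4 * b + 2 * m) * x^2 - 4 * a 3 * x + a 4"
    by (simp add: tangent_quartic_def b_def m_def power4_eq_xxxx power3_eq_cube power2_eq_square algebra_simps)
  moreover have "poly (resolvent_cubic a) s = a 0 * (a 3)^2 + (a 1)^2 * a 4 + b * m^2 - a 0 * b * a 4 - 2 * a 1 * a 3 * m"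
    by (simp add: resolvent_cubic_def b_def m_def power2_eq_square algebra_simps)
  ultimately show ?thesis
    unfolding y Let_def quadratic_disc_coeffs by (simp only: disc_y_aux)
qed

text \<open>
  The discriminants are computed in \<open>disc_param\<close> and \<open>disc_point\<close>; the first determines \<open>P\<close> up to
  sign, and then the second determines \<open>J\<close>.  The sign does not affect the addition form.
\<close>
lemma discriminant_factors_unique:
  assumes "discriminant_factors a P J" "general_position a"
  shows "J = resolvent_cubic a \<or> J = - resolvent_cubic a"
proof -
  define P0 where "P0 = tangent_quartic a"
  have 1: "poly P x * poly P y = poly P0 x * poly P0 y"
    and 2: "poly J s * poly P x = poly (resolvent_cubic a) s * poly P0 x" for x y s
    using assms(1) unfolding discriminant_factors_def disc_param disc_point P0_def by simp_all
  have "P * P = P0 * P0" "J * P = resolvent_cubic a * P0"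
    using 1 2 by (auto simp: poly_eq_poly_eq_iff[symmetric] fun_eq_iff)
  moreover have "P0 \<noteq> 0"
  proof
    assume "P0 = 0"
    then have "poly P0 x = 0" for x by simp
    then have "common_tangent a (Fin x)" for x
      by (simp add: P0_def tangent_quartic_def common_tangent_iff dual_form_def power2_eq_square algebra_simps)
    then have "range Fin \<subseteq> {x. common_tangent a x}" by auto
    moreover have "infinite (range Fin)" by (rule infinite_range_Fin)
    ultimately have "card {x. common_tangent a x} = 0"
      using finite_subset[of "range Fin"] card.infinite by metis
    then show False using assms(2) by (simp add: general_position_def)
  qed
  moreover have "P = P0 \<or> P = - P0"
  proof -
    have "(P - P0) * (P + P0) = 0" using \<open>P * P = P0 * P0\<close> by (simp add: algebra_simps)
    then show ?thesis by (auto simp: eq_neg_iff_add_eq_0)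
  qed
  moreover have "J * P0 = - (J * P)" if "P = - P0" using that by simp
  ultimately have "J * P0 = resolvent_cubic a * P0 \<or> J * P0 = (- resolvent_cubic a) * P0"
    by (metis mult_minus_left)
  then show ?thesis using \<open>P0 \<noteq> 0\<close> by (simp only: mult_cancel_right) blast
qed

section \<open>Associativity of the two-valued group and of its action\<close>

context smooth_cubic
begin

lemma star_sum:
  assumes "A \<in> E" "B \<in> E"
  shows "star J (fst A) (fst B) = {# fst (A \<oplus> B), fst (A \<ominus> B) #}"
  using star_fst[OF degree_J assms] .

lemma fst_neg_add: "A \<in> E \<Longrightarrow> B \<in> E \<Longrightarrow> fst (ell_neg A \<oplus> B) = fst (A \<ominus> B)"
  using neg_add[of A "ell_neg B"] by (metis neg_closed neg_simps(2,3))

lemma point_over: obtains A where "A \<in> E" "fst A = p"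
  using rep by blast

lemma assoc_mixed:
  assumes A: "A \<in> E" and B: "B \<in> E" and C: "C \<in> E"
  shows "(A \<oplus> B) \<ominus> C = A \<oplus> (B \<ominus> C)" "(A \<ominus> B) \<oplus> C = A \<ominus> (B \<ominus> C)" "(A \<ominus> B) \<ominus> C = A \<ominus> (B \<oplus> C)"
  using assms by (simp_all add: add_assoc neg_add)

theorem group_associativity: "group_associativity J"
  unfolding group_associativity_def
proof (intro allI)
  fix P Q R
  obtain A where A: "A \<in> E" "fst A = Q" by (rule point_over)
  obtain B where B: "B \<in> E" "fst B = P" by (rule point_over)
  obtain C where C: "C \<in> E" "fst C = R" by (rule point_over)
  show "(\<Sum>S\<in>#star J P R. star J Q S) = (\<Sum>S\<in>#star J Q P. star J S R)"
    using A(1) B(1) C(1) unfolding A(2)[symmetric] B(2)[symmetric] C(2)[symmetric]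
    by (simp add: star_sum add_assoc assoc_mixed neg_add add_mset_commute)
qed

end

locale uniformized_pencil = smooth_cubic J + based_pencil a e for J a e +
  assumes J_resolvent_cubic: "J = resolvent_cubic a \<or> J = - resolvent_cubic a"
begin

lemma addition_form_J: "addition_form J = addition_form (resolvent_cubic a)"
proof -
  have "addition_form (- I) p q r = addition_form I p q r" for I p q r
    by (simp add: addition_form_def Let_def power2_eq_square algebra_simps split: prod.split)
  then show ?thesis using J_resolvent_cubic by (auto simp: fun_eq_iff)
qed

lemma F_addition_form:
  obtains k where "k \<noteq> 0"
    "\<And>y. F a K x y = k * addition_form J (hom_coords K) (hom_coords (\<phi> x)) (weierstrass_map a e (hom_coords y))"
proof -
  obtain k where k: "k \<noteq> 0"
    "weierstrass_map a e (hom_coords x) = (k * fst (hom_coords (\<phi> x)), k * snd (hom_coords (\<phi> x)))"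
    using phi_scale .
  have "F a K x y = k^2 / (256 * (shift_coeffs a e 3)^2) *
      addition_form J (hom_coords K) (hom_coords (\<phi> x)) (weierstrass_map a e (hom_coords y))" for y
  proof -
    have "256 * (shift_coeffs a e 3)^2 * F a K x y =
        k^2 * addition_form J (hom_coords K) (hom_coords (\<phi> x)) (weierstrass_map a e (hom_coords y))"
      unfolding addition_form_weierstrass[symmetric] addition_form_J[symmetric] k(2)
      by (simp add: addition_form_perm(2)[of J _ _ "weierstrass_map a e (hom_coords y)"] addition_form_scale)
    then show ?thesis using simple by (simp add: field_simps)
  qed
  then show ?thesis using that[of "k^2 / (256 * (shift_coeffs a e 3)^2)"] k simple by simp
qed

text \<open>
  The conics of the pencil act on the tangents by the two-valued addition of the cubic, transported
  by \<open>\<phi>\<close>.  Hence the associativity of the action is that of the group.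
\<close>
lemma act_eq:
  assumes C: "C \<in> E" and A: "A \<in> E" "fst A = \<phi> x"
  shows "act a (fst C) x = {# \<psi> (fst (C \<oplus> A)), \<psi> (fst (C \<ominus> A)) #}"
proof -
  obtain k where k: "k \<noteq> 0" "\<And>y. F a (fst C) x y =
      k * addition_form J (hom_coords (fst C)) (hom_coords (\<phi> x)) (weierstrass_map a e (hom_coords y))"
    using F_addition_form[of "fst C" x] by metis
  obtain l where l: "l \<noteq> 0" "\<And>r. addition_form J (hom_coords (fst C)) (hom_coords (\<phi> x)) r =
      l * wedge r (hom_coords (fst (C \<oplus> A))) * wedge r (hom_coords (fst (C \<ominus> A)))"
    using addition_form_factor[OF C A(1)] unfolding A(2) by metis
  obtain m where m: "m \<noteq> 0" "weierstrass_adj a e (hom_coords (fst (C \<oplus> A))) =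
      (m * fst (hom_coords (\<psi> (fst (C \<oplus> A)))), m * snd (hom_coords (\<psi> (fst (C \<oplus> A)))))"
    using psi_scale .
  obtain n where n: "n \<noteq> 0" "weierstrass_adj a e (hom_coords (fst (C \<ominus> A))) =
      (n * fst (hom_coords (\<psi> (fst (C \<ominus> A)))), n * snd (hom_coords (\<psi> (fst (C \<ominus> A)))))"
    using psi_scale .
  have "F a (fst C) x (Fin y) = (k * l * m * n) *
      wedge (y, 1) (hom_coords (\<psi> (fst (C \<oplus> A)))) * wedge (y, 1) (hom_coords (\<psi> (fst (C \<ominus> A))))" for y
    unfolding k(2) l(2) wedge_weierstrass m(2) n(2) by simp
  then show ?thesis
    unfolding act_def using k(1) l(1) m(1) n(1)
    by (intro quadratic_roots_factored[of "k * l * m * n"]) simp_all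
qed

theorem action_associativity: "action_associativity a Q J"
  unfolding action_associativity_def
proof (intro allI ballI)
  fix P R and M assume "M \<in> curve Q"
  obtain A where A: "A \<in> E" "fst A = \<phi> (fst M)" by (rule point_over)
  obtain B where B: "B \<in> E" "fst B = P" by (rule point_over)
  obtain C where C: "C \<in> E" "fst C = R" by (rule point_over)
  have "act a R (\<psi> (fst D)) = {# \<psi> (fst (C \<oplus> D)), \<psi> (fst (C \<ominus> D)) #}" if "D \<in> E" for D
    using act_eq[OF C(1) that, of "\<psi> (fst D)"] C(2) by simp
  moreover have "act a (fst D) (fst M) = {# \<psi> (fst (D \<oplus> A)), \<psi> (fst (D \<ominus> A)) #}" if "D \<in> E" for D
    using act_eq[OF that A] .
  ultimately show "(\<Sum>x\<in>#act a P (fst M). act a R x) = (\<Sum>S\<in>#star J R P. act a S (fst M))"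
    using A(1) B(1) C(1) unfolding B(2)[symmetric] C(2)[symmetric]
    by (simp add: star_sum add_assoc assoc_mixed neg_add add_mset_commute)
qed

text \<open>
  The addition form is symmetric, so it may also be factored with respect to the conic.
\<close>
lemma F_eq_0_iff:
  assumes A: "A \<in> E" "fst A = \<phi> x" and B: "B \<in> E" "fst B = \<phi> y"
  shows "F a K x y = 0 \<longleftrightarrow> K = fst (A \<oplus> B) \<or> K = fst (A \<ominus> B)"
proof -
  obtain k where k: "k \<noteq> 0" "F a K x y =
      k * addition_form J (hom_coords K) (hom_coords (\<phi> x)) (weierstrass_map a e (hom_coords y))"
    using F_addition_form[of K x] by metis
  obtain m where m: "m \<noteq> 0" "weierstrass_map a e (hom_coords y) =
      (m * fst (hom_coords (\<phi> y)), m * snd (hom_coords (\<phi> y)))"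
    using phi_scale .
  obtain l where l: "l \<noteq> 0" "\<And>r. addition_form J (hom_coords (\<phi> x)) (hom_coords (\<phi> y)) r =
      l * wedge r (hom_coords (fst (A \<oplus> B))) * wedge r (hom_coords (fst (A \<ominus> B)))"
    using addition_form_factor[OF A(1) B(1)] unfolding A(2) B(2) by metis
  have "F a K x y = k * m^2 * addition_form J (hom_coords (\<phi> x)) (hom_coords (\<phi> y)) (hom_coords K)"
    unfolding k(2) m(2) addition_form_scale
    by (simp add: addition_form_perm(1)[of J "hom_coords K"] addition_form_perm(2)[of J _ _ "hom_coords K"])
  then show ?thesis using k(1) m(1) l by auto
qed

end

section \<open>Tangents of the conics at the vertices of a triangle\<close>
definition pairing :: "complex^3 \<Rightarrow> complex^3 \<Rightarrow> complex" where
  "pairing z w = z$1 * w$1 + z$2 * w$2 + z$3 * w$3"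

lemma incident_pairing: "incident z w \<longleftrightarrow> pairing z w = 0"
  by (simp add: incident_def pairing_def)

lemma pairing_linear: "pairing z (\<alpha> *s u + \<beta> *s v) = \<alpha> * pairing z u + \<beta> * pairing z v"
  by (simp add: pairing_def algebra_simps)

lemma pairing_meet_tangent_line:
  "pairing (meet x y) (tangent_line w) = wedge (hom_coords x) (hom_coords w) * wedge (hom_coords y) (hom_coords w)"
  by (cases x; cases y; cases w)
    (simp_all add: pairing_def meet_def wedge_def power2_eq_square field_simps)

lemma meet_commute: "meet x y = meet y x"
  by (simp add: meet_def mult.commute add.commute split: prod.split)

lemma tangent_line_hom:
  assumes "hom_coords x = (x1, x0)"
  shows "tangent_line x $ 1 = x1^2" "tangent_line x $ 2 = - 2 * x1 * x0" "tangent_line x $ 3 = x0^2"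
  using assms by (cases x; simp)+

text \<open>
  On the points of contact \<open>meet v v\<close>, the equations of the two tangents are the squares of
  \<open>wedge x v\<close> and \<open>wedge y v\<close>.  The coefficients are therefore found by evaluating \<open>w\<close> at the
  points of contact of \<open>x\<close> and \<open>y\<close>.
\<close>
lemma line_through_meet:
  assumes "x \<noteq> y" "incident (meet x y) w"
  obtains \<alpha> \<beta> where "w = \<alpha> *s tangent_line x + \<beta> *s tangent_line y"
    and "incident (meet x x) w \<longleftrightarrow> \<beta> = 0"
proof -
  define d where "d = wedge (hom_coords x) (hom_coords y)"
  have d: "d \<noteq> 0" using assms(1) by (simp add: d_def)
  define \<alpha> \<beta> where "\<alpha> = pairing (meet y y) w / d^2" and "\<beta> = pairing (meet x x) w / d^2"
  obtain x1 x0 y1 y0 where h: "hom_coords x = (x1, x0)" "hom_coords y = (y1, y0)"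
    by (cases "hom_coords x"; cases "hom_coords y")
  have on: "2 * x0 * y0 * w$1 + (x1 * y0 + x0 * y1) * w$2 + 2 * x1 * y1 * w$3 = 0"
    using assms(2) by (simp add: incident_def meet_def h field_simps)
  have p: "pairing (meet x x) w = x0^2 * w$1 + x1 * x0 * w$2 + x1^2 * w$3"
    "pairing (meet y y) w = y0^2 * w$1 + y1 * y0 * w$2 + y1^2 * w$3"
    by (simp_all add: pairing_def meet_def h power2_eq_square)
  have "d^2 * w$i = pairing (meet y y) w * tangent_line x $ i + pairing (meet x x) w * tangent_line y $ i" for i
  proof -
    have "d^2 * w$1 = pairing (meet y y) w * x1^2 + pairing (meet x x) w * y1^2"
      "d^2 * w$2 = pairing (meet y y) w * (- 2 * x1 * x0) + pairing (meet x x) w * (- 2 * y1 * y0)"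
      "d^2 * w$3 = pairing (meet y y) w * x0^2 + pairing (meet x x) w * y0^2"
      using on unfolding p d_def wedge_def h fst_conv snd_conv by algebra+
    then show ?thesis
      using exhaust_3[of i] tangent_line_hom[OF h(1)] tangent_line_hom[OF h(2)] by auto
  qed
  then have "w $ i = (pairing (meet y y) w * tangent_line x $ i + pairing (meet x x) w * tangent_line y $ i) / d^2" for i
    using d by (simp add: eq_divide_eq mult.commute)
  then have "w = \<alpha> *s tangent_line x + \<beta> *s tangent_line y"
    by (simp add: vec_eq_iff \<alpha>_def \<beta>_def add_divide_distrib)
  moreover have "incident (meet x x) w \<longleftrightarrow> \<beta> = 0"
    using d by (simp add: \<beta>_def incident_pairing)
  ultimately show ?thesis using that by blast
qed

lemma wedge_self [simp]: "wedge p p = 0"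
  by (simp add: wedge_def)

context uniformized_pencil
begin

text \<open>
  For \<open>A\<close> over \<open>\<phi> x\<close>, a square root of the value at \<open>x\<close> of the tangential form of the pencil, up to a
  constant that does not depend on \<open>x\<close>; the sign is that of the ordinate of \<open>A\<close>.
\<close>
definition weight where "weight x A = (snd (weierstrass_map a e (hom_coords x)))^2 * snd A"

lemma hom_polar_phi:
  assumes "\<phi> x = Fin u" "\<phi> y = Fin v"
  shows "hom_polar J z (weierstrass_map a e (hom_coords x)) (weierstrass_map a e (hom_coords y)) =
    (snd (weierstrass_map a e (hom_coords x)))^2 * (snd (weierstrass_map a e (hom_coords y)))^2 * polar z u v"
proof -
  obtain k where k: "k \<noteq> 0" "weierstrass_map a e (hom_coords x) = (k * fst (hom_coords (\<phi> x)), k * snd (hom_coords (\<phi> x)))"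
    using phi_scale .
  obtain l where l: "l \<noteq> 0" "weierstrass_map a e (hom_coords y) = (l * fst (hom_coords (\<phi> y)), l * snd (hom_coords (\<phi> y)))"
    using phi_scale .
  show ?thesis
    unfolding k(2) l(2) assms by (simp add: hom_polar_def polar_def power2_eq_square algebra_simps)
qed

lemma hom_polar_J:
  obtains c where "c \<noteq> 0"
    "\<And>z p q. hom_polar J z (weierstrass_map a e p) (weierstrass_map a e q) = 2 * c * dual_form a z p q"
proof -
  have "hom_polar (- I) z p q = - hom_polar I z p q" for I z p q
    by (simp add: hom_polar_def algebra_simps split: prod.split)
  then consider "hom_polar J = hom_polar (resolvent_cubic a)" | "\<And>z p q. hom_polar J z p q = - hom_polar (resolvent_cubic a) z p q"
    using J_resolvent_cubic by auto
  then show ?thesis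
  proof cases
    case 1
    then show ?thesis using that[of "16 * (shift_coeffs a e 3)^2"] simple by (simp add: hom_polar_weierstrass)
  next
    case 2
    then show ?thesis using that[of "- 16 * (shift_coeffs a e 3)^2"] simple by (simp add: hom_polar_weierstrass)
  qed
qed

lemma common_tangent_iff_ramified:
  "common_tangent a x \<longleftrightarrow> \<phi> x = Infty \<or> (\<exists>s. \<phi> x = Fin s \<and> poly J s = 0)"
  using J_resolvent_cubic common_tangent_phi by auto

lemma affine_lift:
  assumes "\<not> common_tangent a x" "A \<in> E" "fst A = \<phi> x"
  obtains u t where "A = (Fin u, t)" "t^2 = poly J u" "t \<noteq> 0" "\<phi> x = Fin u"
    "snd (weierstrass_map a e (hom_coords x)) \<noteq> 0" "weight x A \<noteq> 0"
proof -
  obtain u t where A: "A = (Fin u, t)" "t^2 = poly J u" "\<phi> x = Fin u"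
    using assms common_tangent_iff_ramified by (auto elim: E_cases)
  moreover have "t \<noteq> 0" using A assms(1) common_tangent_iff_ramified by auto
  moreover have "snd (weierstrass_map a e (hom_coords x)) \<noteq> 0"
    using A(3) by (auto simp: \<phi>_def of_hom_def split: if_splits)
  ultimately show ?thesis using that by (simp add: weight_def)
qed

text \<open>
  On the lines through the intersection of two tangents \<open>x\<close> and \<open>y\<close>, the tangential form of a
  conic through that point is a perfect square.  Whether the conic belongs to \<open>A - B\<close> or to \<open>A + B\<close>
  decides the sign of the mixed term.
\<close>
lemma pencil_form_difference:
  assumes "x \<noteq> y" and A: "A \<in> E" "fst A = \<phi> x" and B: "B \<in> E" "fst B = \<phi> y"
    and nc: "\<not> common_tangent a x" "\<not> common_tangent a y"
  shows "\<exists>c. c \<noteq> 0 \<and> (\<forall>\<alpha> \<beta>. c * pencil_form a (fst (A \<ominus> B)) (\<alpha> *s tangent_line x + \<beta> *s tangent_line y) =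
      (\<alpha> * weight x A - \<beta> * weight y B)^2)"
proof -
  obtain u t where A': "A = (Fin u, t)" "t^2 = poly J u" "\<phi> x = Fin u"
    using affine_lift[OF nc(1) A] by blast
  obtain v r where B': "B = (Fin v, r)" "r^2 = poly J v" "\<phi> y = Fin v"
    using affine_lift[OF nc(2) B] by blast
  have "u \<noteq> v" using assms(1) A'(3) B'(3) by (metis phi_inj)
  then obtain s where s: "fst (A \<ominus> B) = Fin s" "polar s u v = - 2 * t * r"
    using polar_diff[OF \<open>u \<noteq> v\<close> A'(2) B'(2)] unfolding A'(1) B'(1) by (metis fst_conv)
  obtain c where c: "c \<noteq> 0" "\<And>z p q. hom_polar J z (weierstrass_map a e p) (weierstrass_map a e q) = 2 * c * dual_form a z p q"
    using hom_polar_J by metis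
  have "c * pencil_form a (fst (A \<ominus> B)) (\<alpha> *s tangent_line x + \<beta> *s tangent_line y) =
      (\<alpha> * weight x A - \<beta> * weight y B)^2" for \<alpha> \<beta>
  proof -
    have "2 * (c * pencil_form a (fst (A \<ominus> B)) (\<alpha> *s tangent_line x + \<beta> *s tangent_line y)) =
      \<alpha>^2 * hom_polar J s (weierstrass_map a e (hom_coords x)) (weierstrass_map a e (hom_coords x))
      + 2 * \<alpha> * \<beta> * hom_polar J s (weierstrass_map a e (hom_coords x)) (weierstrass_map a e (hom_coords y))
      + \<beta>^2 * hom_polar J s (weierstrass_map a e (hom_coords y)) (weierstrass_map a e (hom_coords y))"
      unfolding c(2) s(1) pencil_form_tangents by (simp add: algebra_simps)
    also have "\<dots> = 2 * (\<alpha> * weight x A - \<beta> * weight y B)^2"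
      unfolding hom_polar_phi[OF A'(3) A'(3)] hom_polar_phi[OF A'(3) B'(3)] hom_polar_phi[OF B'(3) B'(3)]
        polar_self s(2) A'(2)[symmetric] B'(2)[symmetric] weight_def A'(1) B'(1) snd_conv by algebra
    finally show ?thesis by simp
  qed
  then show ?thesis using c(1) by blast
qed

text \<open>
  So the tangent of this conic is the only line in the pencil of lines with
  \<open>\<alpha> : \<beta> = weight y B : weight x A\<close>.
\<close>
lemma tangent_at_difference:
  assumes "x \<noteq> y" and A: "A \<in> E" "fst A = \<phi> x" and B: "B \<in> E" "fst B = \<phi> y"
    and nc: "\<not> common_tangent a x" "\<not> common_tangent a y"
  shows "tangent_at a (fst (A \<ominus> B)) (meet x y) (weight y B *s tangent_line x + weight x A *s tangent_line y)"
    and "\<And>t z. tangent_at a (fst (A \<ominus> B)) (meet x y) t \<Longrightarrow>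
      incident z t \<longleftrightarrow> weight y B * pairing z (tangent_line x) + weight x A * pairing z (tangent_line y) = 0"
proof -
  obtain c where c: "c \<noteq> 0"
    "\<And>\<alpha> \<beta>. c * pencil_form a (fst (A \<ominus> B)) (\<alpha> *s tangent_line x + \<beta> *s tangent_line y) =
      (\<alpha> * weight x A - \<beta> * weight y B)^2" using pencil_form_difference[OF assms] by blast
  have wA: "weight x A \<noteq> 0" using affine_lift[OF nc(1) A] by blast
  have wB: "weight y B \<noteq> 0" using affine_lift[OF nc(2) B] by blast
  have on: "point_form a (fst (A \<ominus> B)) (meet x y) = 0"
    using F_eq_0_iff[OF A B] unfolding F_def by blast
  have d: "wedge (hom_coords x) (hom_coords y) \<noteq> 0" using assms(1) by simp
  define w where "w = weight y B *s tangent_line x + weight x A *s tangent_line y"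
  have "pairing (meet y y) w = weight y B * (wedge (hom_coords y) (hom_coords x))^2"
    by (simp add: w_def pairing_linear pairing_meet_tangent_line wedge_eq_0_iff power2_eq_square)
  then have "w \<noteq> 0" using wB assms(1) by (auto simp: pairing_def)
  moreover have "pencil_form a (fst (A \<ominus> B)) w = 0"
    using c(1) c(2)[of "weight y B" "weight x A"] by (simp add: w_def mult.commute)
  moreover have "incident (meet x y) w"
    by (simp add: w_def incident_pairing pairing_linear pairing_meet_tangent_line)
  ultimately show "tangent_at a (fst (A \<ominus> B)) (meet x y) w"
    using on by (simp add: tangent_at_def)
  fix t z
  assume t: "tangent_at a (fst (A \<ominus> B)) (meet x y) t"
  obtain \<alpha> \<beta> where ab: "t = \<alpha> *s tangent_line x + \<beta> *s tangent_line y"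
    using line_through_meet[OF assms(1)] t by (metis tangent_at_def)
  have rel: "\<alpha> * weight x A = \<beta> * weight y B"
    using c(2)[of \<alpha> \<beta>] t by (simp add: tangent_at_def ab)
  have "\<beta> \<noteq> 0"
  proof
    assume "\<beta> = 0"
    then have "t = 0" using rel wA ab by simp
    then show False using t by (simp add: tangent_at_def)
  qed
  have "weight x A * pairing z t = \<beta> * (weight y B * pairing z (tangent_line x) + weight x A * pairing z (tangent_line y))"
    using rel unfolding ab pairing_linear by algebra
  then show "incident z t \<longleftrightarrow> weight y B * pairing z (tangent_line x) + weight x A * pairing z (tangent_line y) = 0"
    using \<open>\<beta> \<noteq> 0\<close> wA by (metis incident_pairing mult_eq_0_iff)
qed


lemma weight_neg [simp]: "weight x (ell_neg A) = - weight x A"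
  by (cases A) (simp add: weight_def)

lemma fst_diff_commute: "A \<in> E \<Longrightarrow> B \<in> E \<Longrightarrow> fst (A \<ominus> B) = fst (B \<ominus> A)"
  using fst_neg_add[of B A] add_commute[of "ell_neg B" A] by simp

end

lemma tangent_at_contact: "tangent_at a Infty (meet x x) (tangent_line x)"
  using F_Infty[of a x x] tangent_line_tangent[of x] tangent_line_nonzero[of x] incident_meet(1)[of x x]
  by (simp add: tangent_at_def F_def)

lemma inscribed_tangents:
  assumes "inscribed a K1 K2 K3 x1 x2 x3"
  obtains t1 t2 t3 where "tangent_at a K1 (meet x1 x2) t1" "tangent_at a K2 (meet x2 x3) t2"
    "tangent_at a K3 (meet x1 x3) t3"
  using assms ex_tangent_at[OF meet_nonzero] unfolding inscribed_def F_def by metis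

text \<open>
  If one of the conics is \<open>C\<^sub>2\<close> itself, then two sides of the triangle coincide and the common side
  is a tangent at its point of contact; the other two vertices are the same point of this side.
\<close>
lemma concurrent_if_Infty:
  assumes "inscribed a K1 K2 K3 x1 x2 x3" and "K1 = Infty \<or> K2 = Infty \<or> K3 = Infty"
  shows "\<not> tangents_not_concurrent a K1 K2 K3 x1 x2 x3"
proof -
  obtain t1 t2 t3 where t: "tangent_at a K1 (meet x1 x2) t1" "tangent_at a K2 (meet x2 x3) t2"
    "tangent_at a K3 (meet x1 x3) t3" using inscribed_tangents[OF assms(1)] .
  have i: "incident (meet x1 x2) t1" "incident (meet x2 x3) t2" "incident (meet x1 x3) t3"
    using t by (simp_all add: tangent_at_def)
  have F: "F a K1 x1 x2 = 0" "F a K2 x2 x3 = 0" "F a K3 x1 x3 = 0"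
    using assms(1) by (simp_all add: inscribed_def)
  from assms(2) consider "K1 = Infty" "x1 = x2" | "K2 = Infty" "x2 = x3" | "K3 = Infty" "x1 = x3"
    using F by (auto simp: F_Infty)
  then show ?thesis
  proof cases
    case 1
    then have "concurrent (tangent_line x1) t2 t3"
      using i meet_nonzero[of x1 x3] incident_meet[of x1 x3] by (auto simp: concurrent_def)
    then show ?thesis using t tangent_at_contact[of a x1] 1 unfolding tangents_not_concurrent_def by blast
  next
    case 2
    then have "concurrent t1 (tangent_line x2) t3"
      using i meet_nonzero[of x1 x2] incident_meet[of x1 x2] by (auto simp: concurrent_def)
    then show ?thesis using t tangent_at_contact[of a x2] 2 unfolding tangents_not_concurrent_def by blast
  next
    case 3
    then have "concurrent t1 t2 (tangent_line x1)"
      using i meet_nonzero[of x1 x2] incident_meet[of x1 x2] by (auto simp: concurrent_def meet_commute[of x2])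
    then show ?thesis using t tangent_at_contact[of a x1] 3 unfolding tangents_not_concurrent_def by blast
  qed
qed

text \<open>
  If two sides coincide and the conics at the two coinciding vertices are equal, then the same tangent
  can be taken twice.
\<close>
lemma concurrent_if_shared_vertex:
  assumes "inscribed a K1 K2 K3 x1 x2 x3"
    and "x1 = x2 \<and> K2 = K3 \<or> x2 = x3 \<and> K1 = K3 \<or> x1 = x3 \<and> K1 = K2"
  shows "\<not> tangents_not_concurrent a K1 K2 K3 x1 x2 x3"
proof -
  obtain t1 t2 t3 where t: "tangent_at a K1 (meet x1 x2) t1" "tangent_at a K2 (meet x2 x3) t2"
    "tangent_at a K3 (meet x1 x3) t3" using inscribed_tangents[OF assms(1)] .
  have c: "concurrent u v v" "concurrent u v u" "concurrent u u v" for u v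
    using ex_common_point[of u v] by (auto simp: concurrent_def)
  from assms(2) show ?thesis
    unfolding tangents_not_concurrent_def using t c meet_commute by metis
qed

context uniformized_pencil
begin

lemma inscribed_if_differences:
  assumes "A1 \<in> E" "fst A1 = \<phi> x1" "A2 \<in> E" "fst A2 = \<phi> x2" "A3 \<in> E" "fst A3 = \<phi> x3"
    and "K1 = fst (A1 \<ominus> A2)" "K2 = fst (A2 \<ominus> A3)" "K3 = fst (A1 \<ominus> A3) \<or> K3 = fst (A1 \<oplus> A3)"
  shows "inscribed a K1 K2 K3 x1 x2 x3"
  using assms(7-9) F_eq_0_iff[OF assms(1-4)] F_eq_0_iff[OF assms(3-6)] F_eq_0_iff[OF assms(1,2,5,6)]
  unfolding inscribed_def by blast

text \<open>
  Signs that do not fit together make the tangents concurrent.  Let \<open>l\<^sub>i\<close> be the sides and \<open>w\<^sub>i\<close>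
  the weights of the lifts.  For distinct sides that are not common tangents, the tangents have the
  equations \<open>w\<^sub>2 l\<^sub>1 + w\<^sub>1 l\<^sub>2\<close>, \<open>w\<^sub>3 l\<^sub>2 + w\<^sub>2 l\<^sub>3\<close>, \<open>- w\<^sub>3 l\<^sub>1 + w\<^sub>1 l\<^sub>3\<close>, which are linearly dependent.
  If two sides coincide, then so do two lifts up to sign, and one of the lemmas
  \<open>concurrent_if_Infty\<close> and \<open>concurrent_if_shared_vertex\<close> applies.
\<close>
lemma concurrent_if_sum:
  assumes A1: "A1 \<in> E" "fst A1 = \<phi> x1" and A2: "A2 \<in> E" "fst A2 = \<phi> x2" and A3: "A3 \<in> E" "fst A3 = \<phi> x3"
    and K: "K1 = fst (A1 \<ominus> A2)" "K2 = fst (A2 \<ominus> A3)" "K3 = fst (A1 \<oplus> A3)"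
  shows "\<not> tangents_not_concurrent a K1 K2 K3 x1 x2 x3"
proof -
  have ins: "inscribed a K1 K2 K3 x1 x2 x3" using inscribed_if_differences assms by blast
  consider "common_tangent a x1 \<or> common_tangent a x2 \<or> common_tangent a x3"
    | "x1 = x2" | "x2 = x3" | "x1 = x3"
    | (generic) "\<not> common_tangent a x1" "\<not> common_tangent a x2" "\<not> common_tangent a x3"
      "x1 \<noteq> x2" "x2 \<noteq> x3" "x1 \<noteq> x3" by blast
  then show ?thesis
  proof cases
    case 1
    then show ?thesis using common_tangent_concurrent[OF ins] by blast
  next
    case 2
    then have "A2 = A1 \<or> A2 = ell_neg A1" using curve_fst_eq A1 A2 by simp
    then show ?thesis
    proof
      assume "A2 = A1"
      then show ?thesis using concurrent_if_Infty[OF ins] K(1) A1 by simp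
    next
      assume "A2 = ell_neg A1"
      then have "K2 = K3" using K neg_add[of A1 A3] A1 A3 by (metis neg_simps(3))
      then show ?thesis using concurrent_if_shared_vertex[OF ins] 2 by blast
    qed
  next
    case 3
    then have "A3 = A2 \<or> A3 = ell_neg A2" using curve_fst_eq A3 A2 by simp
    then show ?thesis
    proof
      assume "A3 = A2"
      then show ?thesis using concurrent_if_Infty[OF ins] K(2) A2 by simp
    next
      assume "A3 = ell_neg A2"
      then show ?thesis using concurrent_if_shared_vertex[OF ins] 3 K by simp
    qed
  next
    case 4
    then have "A3 = A1 \<or> A3 = ell_neg A1" using curve_fst_eq A3 A1 by simp
    then show ?thesis
    proof
      assume "A3 = A1"
      then show ?thesis using concurrent_if_shared_vertex[OF ins] 4 K fst_diff_commute A1 A2 by simp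
    next
      assume "A3 = ell_neg A1"
      then show ?thesis using concurrent_if_Infty[OF ins] K(3) A1 by simp
    qed
  next
    case generic
    define t1 where "t1 = weight x2 A2 *s tangent_line x1 + weight x1 A1 *s tangent_line x2"
    define t2 where "t2 = weight x3 A3 *s tangent_line x2 + weight x2 A2 *s tangent_line x3"
    define t3 where "t3 = weight x3 (ell_neg A3) *s tangent_line x1 + weight x1 A1 *s tangent_line x3"
    have t: "tangent_at a K1 (meet x1 x2) t1" "tangent_at a K2 (meet x2 x3) t2" "tangent_at a K3 (meet x1 x3) t3"
      using tangent_at_difference(1)[OF generic(4) A1 A2 generic(1,2)]
        tangent_at_difference(1)[OF generic(5) A2 A3 generic(2,3)]
        tangent_at_difference(1)[OF generic(6) A1, of "ell_neg A3"] A3 generic(1,3)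
      unfolding K t1_def t2_def t3_def by simp_all
    obtain z where z: "z \<noteq> 0" "pairing z t1 = 0" "pairing z t2 = 0"
      using ex_common_point[of t1 t2] by (auto simp: incident_pairing)
    have "weight x2 A2 * pairing z t3 = 0"
      using z(2,3) unfolding t1_def t2_def t3_def pairing_linear weight_neg by algebra
    moreover have "weight x2 A2 \<noteq> 0" using affine_lift[OF generic(2) A2] by blast
    ultimately have "concurrent t1 t2 t3"
      using z unfolding concurrent_def incident_pairing by auto
    then show ?thesis using t unfolding tangents_not_concurrent_def by blast
  qed
qed

text \<open>
  The case of a triangle with a double side \<open>x\<close>.  The tangents \<open>u\<close> and \<open>v\<close> differ, so they meet only
  in the intersection of \<open>x\<close> and \<open>y\<close>.  If \<open>t\<close>, which passes through the point of contact of \<open>x\<close>,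
  passed through this point as well, then \<open>t\<close> would be the line \<open>x\<close>; but \<open>x\<close> is not a common tangent,
  so it touches no conic of the pencil other than \<open>C\<^sub>2\<close>.
\<close>
lemma not_concurrent_double:
  assumes "x \<noteq> y" and A: "A \<in> E" "fst A = \<phi> x" and B: "B \<in> E" "fst B = \<phi> y"
    and nc: "\<not> common_tangent a x" "\<not> common_tangent a y"
    and t: "tangent_at a K (meet x x) t" "K \<noteq> Infty" "tangent_at a (fst (A \<ominus> B)) (meet x y) u"
      "tangent_at a (fst (A \<oplus> B)) (meet x y) v"
    and z: "z \<noteq> 0" "incident z t" "incident z u" "incident z v"
  shows False
proof -
  have wA: "weight x A \<noteq> 0" using affine_lift[OF nc(1) A] by blast
  have wB: "weight y B \<noteq> 0" using affine_lift[OF nc(2) B] by blast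
  define p q where "p = pairing z (tangent_line x)" and "q = pairing z (tangent_line y)"
  have "weight y B * p + weight x A * q = 0"
    using tangent_at_difference(2)[OF assms(1) A B nc t(3)] z(3) by (simp add: p_def q_def)
  moreover have "- weight y B * p + weight x A * q = 0"
    using tangent_at_difference(2)[OF assms(1) A, of "ell_neg B", OF _ _ nc] B t(4) z(4) by (simp add: p_def q_def)
  ultimately have "2 * (weight x A * q) = 0" "2 * (weight y B * p) = 0" by algebra+
  then have "p = 0" "q = 0" using wA wB by simp_all
  then obtain c where c: "c \<noteq> 0" "z = c *s meet x y"
    using meet_unique[OF assms(1) z(1)] by (auto simp: p_def q_def incident_pairing)
  have "incident (meet x y) t"
    using z(2) c by (simp add: incident_def) (metis (no_types) distrib_left mult.assoc mult_eq_0_iff)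
  then obtain \<alpha> \<beta> where ab: "t = \<alpha> *s tangent_line x + \<beta> *s tangent_line y"
    "incident (meet x x) t \<longleftrightarrow> \<beta> = 0" using line_through_meet[OF assms(1)] by blast
  then have t': "t = \<alpha> *s tangent_line x" using t(1) by (simp add: tangent_at_def)
  obtain s where s: "K = Fin s" using t(2) by (cases K) auto
  have "pencil_form a (Fin s) (\<alpha> *s w) = \<alpha>^2 * pencil_form a (Fin s) w" for w
    by (simp add: C1_form_def C2_form_def power2_eq_square algebra_simps)
  then have "pencil_form a K t = \<alpha>^2 * dual_form a 0 (hom_coords x) (hom_coords x)"
    by (simp only: t' s pencil_form_tangent)
  then have "\<alpha> = 0" using t(1) nc(1) by (simp add: tangent_at_def common_tangent_iff)
  then show False using t(1) t' by (simp add: tangent_at_def)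
qed

text \<open>
  Signs that fit together prevent concurrency.  For distinct sides \<open>l\<^sub>i\<close> the tangents have the equations
  \<open>w\<^sub>2 l\<^sub>1 + w\<^sub>1 l\<^sub>2\<close>, \<open>w\<^sub>3 l\<^sub>2 + w\<^sub>2 l\<^sub>3\<close>, \<open>w\<^sub>3 l\<^sub>1 + w\<^sub>1 l\<^sub>3\<close>, which vanish together only where all \<open>l\<^sub>i\<close> do.
\<close>
lemma not_concurrent_if_difference:
  assumes A1: "A1 \<in> E" "fst A1 = \<phi> x1" and A2: "A2 \<in> E" "fst A2 = \<phi> x2" and A3: "A3 \<in> E" "fst A3 = \<phi> x3"
    and K: "K1 = fst (A1 \<ominus> A2)" "K2 = fst (A2 \<ominus> A3)" "K3 = fst (A1 \<ominus> A3)"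
    and fin: "K1 \<noteq> Infty" "K2 \<noteq> Infty" "K3 \<noteq> Infty"
    and nc: "\<not> common_tangent a x1" "\<not> common_tangent a x2" "\<not> common_tangent a x3"
  shows "tangents_not_concurrent a K1 K2 K3 x1 x2 x3"
  unfolding tangents_not_concurrent_def
proof (intro allI impI notI)
  fix t1 t2 t3
  assume t: "tangent_at a K1 (meet x1 x2) t1" "tangent_at a K2 (meet x2 x3) t2" "tangent_at a K3 (meet x1 x3) t3"
    and "concurrent t1 t2 t3"
  then obtain z where z: "z \<noteq> 0" "incident z t1" "incident z t2" "incident z t3"
    by (auto simp: concurrent_def)
  have ne: "A1 \<noteq> A2" "A2 \<noteq> A3" "A1 \<noteq> A3" using K fin A1 A2 A3 by auto
  have eq: "Ai = ell_neg Aj" if "\<phi> xi = \<phi> xj" "Ai \<in> E" "fst Ai = \<phi> xi" "Aj \<in> E" "fst Aj = \<phi> xj" "Ai \<noteq> Aj" for xi xj Ai Aj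
    using curve_fst_eq[of Aj J Ai] that by simp
  consider "x1 = x2" | "x2 = x3" | "x1 = x3" | (distinct) "x1 \<noteq> x2" "x2 \<noteq> x3" "x1 \<noteq> x3" by blast
  then show False
  proof cases
    case 1
    have A2': "A2 = ell_neg A1" using eq[of x2 x1 A2 A1] 1 A1 A2 ne by simp
    have "x1 \<noteq> x3" using eq[of x3 x1 A3 A1] A1 A3 ne A2' by auto
    moreover have "K2 = fst (A1 \<oplus> A3)" using K(2) A2' neg_add[of A1 A3] A1 A3 by (metis neg_simps(3))
    ultimately show False
      using not_concurrent_double[of x1 x3 A1 A3 K1 t1 t3 t2 z] A1 A3 nc t z fin K 1 by simp
  next
    case 2
    have A3': "A3 = ell_neg A2" using eq[of x3 x2 A3 A2] 2 A2 A3 ne by simp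
    have "x2 \<noteq> x1" using eq[of x1 x2 A1 A2] A1 A2 ne A3' by auto
    moreover have "K1 = fst (A2 \<ominus> A1)" "K3 = fst (A2 \<oplus> A1)"
      using K A3' A1 A2 fst_diff_commute[of A1 A2] add_commute[of A1 A2] by simp_all
    ultimately show False
      using not_concurrent_double[of x2 x1 A2 A1 K2 t2 t1 t3 z] A1 A2 nc t z fin 2 by (simp add: meet_commute)
  next
    case 3
    have A3': "A3 = ell_neg A1" using eq[of x3 x1 A3 A1] 3 A1 A3 ne by simp
    have "x1 \<noteq> x2" using eq[of x2 x1 A2 A1] A1 A2 ne A3' by auto
    moreover have "K2 = fst (A1 \<oplus> A2)"
      using K A3' A1 A2 add_commute[of A1 A2] by simp
    ultimately show False
      using not_concurrent_double[of x1 x2 A1 A2 K3 t3 t1 t2 z] A1 A2 nc t z fin K 3 by (simp add: meet_commute)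
  next
    case distinct
    define p where "p x = pairing z (tangent_line x)" for x
    have w: "weight x1 A1 \<noteq> 0" "weight x2 A2 \<noteq> 0" "weight x3 A3 \<noteq> 0"
      using affine_lift[OF nc(1) A1] affine_lift[OF nc(2) A2] affine_lift[OF nc(3) A3] by blast+
    have "weight x2 A2 * p x1 + weight x1 A1 * p x2 = 0"
      "weight x3 A3 * p x2 + weight x2 A2 * p x3 = 0" "weight x3 A3 * p x1 + weight x1 A1 * p x3 = 0"
      using tangent_at_difference(2)[OF distinct(1) A1 A2 nc(1,2), of t1 z]
        tangent_at_difference(2)[OF distinct(2) A2 A3 nc(2,3), of t2 z]
        tangent_at_difference(2)[OF distinct(3) A1 A3 nc(1,3), of t3 z] t z unfolding K p_def by blast+
    then have "2 * weight x2 A2 * weight x3 A3 * p x1 = 0" "2 * weight x1 A1 * weight x3 A3 * p x2 = 0"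
      "2 * weight x1 A1 * weight x2 A2 * p x3 = 0" by algebra+
    then have p: "p x1 = 0" "p x2 = 0" "p x3 = 0" using w by simp_all
    then obtain c where c: "c \<noteq> 0" "z = c *s meet x1 x2"
      using meet_unique[OF distinct(1) z(1)] by (auto simp: p_def incident_pairing)
    have "pairing (c *s v) w = c * pairing v w" for v w by (simp add: pairing_def algebra_simps)
    then have "p x3 \<noteq> 0" using c distinct by (simp add: p_def pairing_meet_tangent_line)
    then show False using p by simp
  qed
qed

section \<open>The Great Poncelet Theorem from the group law\<close>

text \<open>
  By \<open>concurrent_if_sum\<close> the hypothesis on the tangents says that \<open>K3\<close> is the class of \<open>k1 + k2\<close> for
  lifts \<open>k1\<close> and \<open>k2\<close> of \<open>K1\<close> and \<open>K2\<close>.  This does not depend on the triangle, so if \<open>B1 - B2 = k1\<close>,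
  the third side is the class of \<open>B2 - k2\<close>.
\<close>
theorem great_poncelet: "great_poncelet_triangle a"
  unfolding great_poncelet_triangle_def
proof (intro allI impI)
  fix K1 K2 K3 a1 a2 a3 b1 b2
  assume ins: "inscribed a K1 K2 K3 a1 a2 a3" and tnc: "tangents_not_concurrent a K1 K2 K3 a1 a2 a3"
    and b: "F a K1 b1 b2 = 0"
  \<comment> \<open>Replacing \<open>B\<close> by \<open>-B\<close> turns a sum into a difference.\<close>
  have choose: "\<exists>B. B \<in> E \<and> fst B = \<phi> y \<and> K = fst (A \<ominus> B)"
    if A: "A \<in> E" "fst A = \<phi> x" and F: "F a K x y = 0" for A x y K
  proof -
    obtain B where B: "B \<in> E" "fst B = \<phi> y" by (rule point_over)
    from F_eq_0_iff[OF A B, of K] F show ?thesis using B by (metis neg_closed neg_simps(2,3))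
  qed
  have fin: "K1 \<noteq> Infty" "K2 \<noteq> Infty" "K3 \<noteq> Infty" using concurrent_if_Infty[OF ins] tnc by blast+
  obtain A1 where A1: "A1 \<in> E" "fst A1 = \<phi> a1" by (rule point_over)
  obtain A2 where A2: "A2 \<in> E" "fst A2 = \<phi> a2" "K1 = fst (A1 \<ominus> A2)"
    using choose[OF A1] ins unfolding inscribed_def by blast
  obtain A3 where A3: "A3 \<in> E" "fst A3 = \<phi> a3" "K2 = fst (A2 \<ominus> A3)"
    using choose[OF A2(1,2)] ins unfolding inscribed_def by blast
  have K3: "K3 = fst (A1 \<ominus> A3)"
    using F_eq_0_iff[OF A1 A3(1,2), of K3] ins concurrent_if_sum[OF A1 A2(1,2) A3(1,2) A2(3) A3(3)] tnc
    by (auto simp: inscribed_def)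
  define k1 k2 where "k1 = A1 \<ominus> A2" and "k2 = A2 \<ominus> A3"
  have k: "k1 \<in> E" "k2 \<in> E" "A1 \<ominus> A3 = k1 \<oplus> k2"
    using A1 A2 A3 by (simp_all add: k1_def k2_def diff_add_diff)
  obtain B1 B2 where B1: "B1 \<in> E" "fst B1 = \<phi> b1" and B2: "B2 \<in> E" "fst B2 = \<phi> b2" and B12: "B1 \<ominus> B2 = k1"
  proof -
    obtain C1 where C1: "C1 \<in> E" "fst C1 = \<phi> b1" by (rule point_over)
    obtain C2 where C2: "C2 \<in> E" "fst C2 = \<phi> b2" "K1 = fst (C1 \<ominus> C2)"
      using choose[OF C1 b] by blast
    have "C1 \<ominus> C2 = k1 \<or> C1 \<ominus> C2 = ell_neg k1"
      using curve_fst_eq[of k1 J "C1 \<ominus> C2"] k C1 C2 A2(3) by (simp add: k1_def)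
    then show ?thesis
    proof
      assume "C1 \<ominus> C2 = k1"
      then show ?thesis using that[of C1 C2] C1 C2 by blast
    next
      assume "C1 \<ominus> C2 = ell_neg k1"
      then have "ell_neg C1 \<ominus> ell_neg C2 = k1"
        using neg_add[of C1 "ell_neg C2"] C1 C2 by simp
      then show ?thesis using that[of "ell_neg C1" "ell_neg C2"] C1 C2 by simp
    qed
  qed
  define B3 where "B3 = B2 \<ominus> k2"
  define b3 where "b3 = \<psi> (fst B3)"
  have B3: "B3 \<in> E" "fst B3 = \<phi> b3" using B2 k by (simp_all add: B3_def b3_def)
  have "B3 \<ominus> B2 = ell_neg k2"
    using add_diff_cancel[of "ell_neg k2" B2] add_commute[of B2 "ell_neg k2"] B2 k by (simp add: B3_def)
  then have B23: "B2 \<ominus> B3 = k2"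
    using neg_add[of B3 "ell_neg B2"] add_commute[of "ell_neg B3" B2] B2 B3 by simp
  have B13: "B1 \<ominus> B3 = k1 \<oplus> k2"
    using diff_add_diff[OF B1(1) B2(1) B3(1)] B12 B23 by simp
  have K: "K1 = fst (B1 \<ominus> B2)" "K2 = fst (B2 \<ominus> B3)" "K3 = fst (B1 \<ominus> B3)"
    using A2(3) A3(3) K3 k(3) B12 B23 B13 by (simp_all add: k1_def k2_def)
  show "\<exists>b3. inscribed a K1 K2 K3 b1 b2 b3 \<and>
      (common_tangent a b1 \<or> common_tangent a b2 \<or> common_tangent a b3 \<or>
       tangents_not_concurrent a K1 K2 K3 b1 b2 b3)"
    using inscribed_if_differences[OF B1 B2 B3 K(1,2)] K(3) not_concurrent_if_difference[OF B1 B2 B3 K fin] by blast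
qed

end

lemma smooth_cubic_minus: "smooth_cubic I \<Longrightarrow> smooth_cubic (- I)"
  by (simp add: smooth_cubic_def pderiv_minus)

theorem theorem7:
  fixes a :: "nat \<Rightarrow> complex" and P J :: "complex poly"
  assumes "general_position a"
    and "discriminant_factors a P J"
  shows "group_associativity J \<and> action_associativity a P J \<longleftrightarrow> great_poncelet_triangle a"
proof -
  obtain e where e: "shift_coeffs a e 4 = 0" "shift_coeffs a e 3 \<noteq> 0"
    using general_position_base[OF assms(1)] .
  interpret based_pencil a e using e by unfold_locales
  have J: "J = resolvent_cubic a \<or> J = - resolvent_cubic a"
    using discriminant_factors_unique[OF assms(2,1)] .
  then have "smooth_cubic J"
    using smooth_resolvent_cubic[OF assms(1)] smooth_cubic_minus by blast
  then interpret uniformized_pencil J a e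
    using J by (simp add: uniformized_pencil_def uniformized_pencil_axioms_def based_pencil_axioms)
  show ?thesis
    using group_associativity action_associativity great_poncelet by blast
qed

end
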